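(* Consider the MAX cost on an $s$–$t$ graph $G$ with $n\ge 1$ agents, $k\ge 1$ interceptors and parameter $\alpha>0$ with $\alpha>\frac{|p_{max}|-|p_{min}|}{k}$. Let $\varepsilon>0$. Then: (a) If $\alpha\ge\frac{m_c}{k\varepsilon\,\mathcal{E}_{m_c,n}}\left(n|p_{max}|-(1+\varepsilon)|p_{min}|\right)$, then $\min_{\sigma\in\mathcal{U}_n}F_n(\sigma,\alpha)\le(1+\varepsilon)\min_{\sigma\in(\Delta(P_{st}))^n}F_n(\sigma,\alpha)$. (b) If $\alpha\ge\frac{m_c}{k\varepsilon}\left(n|p_{max}|-(1+\varepsilon)|p_{min}|\right)$, then $\frac{r(G,n,k,\alpha)}{r_U(G,n,k,\alpha)}\in\left[\frac{1}{1+\varepsilon},1+\varepsilon\right]$. (c) 1. $r(G,n,k,\alpha)\le\min(m_c,n)$. 2. If $\alpha\ge\frac{m_c}{k\,\mathcal{E}_{m_c,n}\varepsilon}\left(n|p_{max}|-(1+\varepsilon)\mathcal{E}_{m_c,n}|p_{min}|\right)$, then $r(G,n,k,\alpha)\le(1+\varepsilon)\mathcal{E}_{m_c,n}$. 3. If $\alpha\ge\frac{m_c}{k\,\mathcal{E}_{m_c,n}\varepsilon}\left((1-\varepsilon)\mathcal{E}_{m_c,n}\,n|p_{max}|-|p_{min}|\right)$, then $r(G,n,k,\alpha)\ge(1-\varepsilon)\mathcal{E}_{m_c,n}$. 4. $\lim_{\alpha\to\infty}r(G,n,k,\alpha)=\mathcal{E}_{m_c,n}$.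
   Context: Graph: $G=(V,E,s,t)$ is a finite directed acyclic multigraph ($E$ is a multiset) with source $s$ and sink $t\neq s$, such that $E\ne\emptyset$ and every edge lies on some directed $s$–$t$ path. $P_{st}$ is the set of directed $s$–$t$ paths; a path is treated as a set of edges and $|p|$ is its number of edges. $p_{max},p_{min}$ are a longest and a shortest path in $P_{st}$. $m_c=m_c(G)$ is the minimum size of an $s$–$t$ cut of $G$. Strategies: each of the $n$ agents picks a path, giving $a=(a_1,\dots,a_n)\in(P_{st})^n$; the $k$ interceptors pick $d=(d_1,\dots,d_k)\in E^k$. $\Delta X$ is the set of probability distributions on $X$. An element $\sigma=(\sigma_1,\dots,\sigma_n)\in(\Delta(P_{st}))^n$ is identified with the product distribution on $(P_{st})^n$ (uncorrelated agents); correlated agents use arbitrary $\sigma\in\Delta((P_{st})^n)$. MAX cost: $C(a,d,\alpha)=\max_{i\in[n]}\left(|a_i|+\alpha\sum_{j\in[k]}\mathbf 1\{d_j\in a_i\}\right)$. For a distribution $\sigma$ on $(P_{st})^n$, $F_n(\sigma,\alpha)=\max_{d\in E^k}\mathbb{E}_{a\sim\sigma}[C(a,d,\alpha)]$. Price of uncorrelation: $$r(G,n,k,\alpha)=\frac{\min_{\sigma\in(\Delta(P_{st}))^n}F_n(\sigma,\alpha)}{\min_{\sigma\in\Delta((P_{st})^n)}F_n(\sigma,\alpha)}.$$ Uniform strategies: let $MF$ be the collection of inclusion-maximal sets of pairwise edge-disjoint $s$–$t$ paths. For each such set, order its paths as $p_1,\dots,p_{m'}$ with $|p_1|\le\dots\le|p_{m'}|$;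 its prefixes are the sets $\{p_1,\dots,p_i\}$, $1\le i\le m'$. $\mathcal{U}_n$ is the set of all $U_P^n$ where $P$ is a prefix of some member of $MF$, $U_P$ is the uniform distribution on $P$, and $U_P^n$ is the product of $n$ copies of $U_P$. The uniform price of uncorrelation is $$r_U(G,n,k,\alpha)=\frac{\min_{\sigma\in\mathcal{U}_n}F_n(\sigma,\alpha)}{\min_{\sigma\in\mathcal{U}_1}F_1(\sigma,\alpha)}.$$ Notation: $\mathcal{E}_{\ell,n}=\ell\left(1-\left(1-\frac1\ell\right)^n\right)$. *)

theory Defs
  imports "HOL-Probability.Probability" "Graph_Theory.Arc_Walk"
begin

text \<open>Parallel edges are distinct elements of \<open>arcs G\<close> with the same tail and head.\<close>

locale st_dag = fin_digraph G for G :: "('v, 'e) pre_digraph" +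
  fixes s t :: 'v
  assumes source_in_verts: "s \<in> verts G"
    and sink_in_verts: "t \<in> verts G"
    and source_neq_sink: "s \<noteq> t"
    and acyclic: "\<not> (\<exists>c. cycle c)"
    and arcs_nonempty: "arcs G \<noteq> {}"
    and arc_on_st_path: "\<And>e. e \<in> arcs G \<Longrightarrow> \<exists>p. apath s p t \<and> e \<in> set p"

definition st_paths :: "('v, 'e) pre_digraph \<Rightarrow> 'v \<Rightarrow> 'v \<Rightarrow> 'e set set" where
  "st_paths G s t = {set p |p. pre_digraph.apath G s p t}"

definition p_max :: "('v, 'e) pre_digraph \<Rightarrow> 'v \<Rightarrow> 'v \<Rightarrow> nat" where
  "p_max G s t = Max (card ` st_paths G s t)"

definition p_min :: "('v, 'e) pre_digraph \<Rightarrow> 'v \<Rightarrow> 'v \<Rightarrow> nat" where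
  "p_min G s t = Min (card ` st_paths G s t)"

definition cut_arcs :: "('v, 'e) pre_digraph \<Rightarrow> 'v set \<Rightarrow> 'e set" where
  "cut_arcs G S = {e \<in> arcs G. tail G e \<in> S \<and> head G e \<notin> S}"

definition min_cut :: "('v, 'e) pre_digraph \<Rightarrow> 'v \<Rightarrow> 'v \<Rightarrow> nat" where
  "min_cut G s t = Min {card (cut_arcs G S) |S. S \<subseteq> verts G \<and> s \<in> S \<and> t \<notin> S}"

text \<open>
  The minimum of \<open>f\<close> over \<open>S\<close> as an attained value, not merely an infimum:
  if no least value exists, nothing can be derived about \<open>min_over f S\<close>.
\<close>

definition min_over :: "('a \<Rightarrow> real) \<Rightarrow> 'a set \<Rightarrow> real" where
  "min_over f S = (LEAST v. v \<in> f ` S)"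

definition Delta :: "'a set \<Rightarrow> 'a pmf set" where
  "Delta X = {\<sigma>. set_pmf \<sigma> \<subseteq> X}"

text \<open>
  \<open>X\<^sup>n\<close> is the set of functions on \<open>{..<n}\<close> with values in \<open>X\<close> that are \<open>undefined\<close>
  elsewhere; hence the default value \<open>undefined\<close> in the product distributions below.
\<close>

abbreviation tuples :: "nat \<Rightarrow> 'a set \<Rightarrow> (nat \<Rightarrow> 'a) set" where
  "tuples n X \<equiv> {..<n} \<rightarrow>\<^sub>E X"

definition product_dist :: "nat \<Rightarrow> (nat \<Rightarrow> 'a pmf) \<Rightarrow> (nat \<Rightarrow> 'a) pmf" where
  "product_dist n \<sigma> = Pi_pmf {..<n} undefined \<sigma>"

definition correlated ::
    "('v, 'e) pre_digraph \<Rightarrow> 'v \<Rightarrow> 'v \<Rightarrow> nat \<Rightarrow> (nat \<Rightarrow> 'e set) pmf set" where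
  "correlated G s t n = Delta (tuples n (st_paths G s t))"

definition uncorrelated ::
    "('v, 'e) pre_digraph \<Rightarrow> 'v \<Rightarrow> 'v \<Rightarrow> nat \<Rightarrow> (nat \<Rightarrow> 'e set) pmf set" where
  "uncorrelated G s t n = product_dist n ` tuples n (Delta (st_paths G s t))"

definition max_cost ::
    "nat \<Rightarrow> nat \<Rightarrow> (nat \<Rightarrow> 'e set) \<Rightarrow> (nat \<Rightarrow> 'e) \<Rightarrow> real \<Rightarrow> real" where
  "max_cost n k a d \<alpha> =
     Max ((\<lambda>i. real (card (a i)) + \<alpha> * (\<Sum>j<k. of_bool (d j \<in> a i))) ` {..<n})"

definition F ::
    "('v, 'e) pre_digraph \<Rightarrow> nat \<Rightarrow> nat \<Rightarrow> real \<Rightarrow> (nat \<Rightarrow> 'e set) pmf \<Rightarrow> real" where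
  "F G n k \<alpha> \<sigma> =
     Max ((\<lambda>d. measure_pmf.expectation \<sigma> (\<lambda>a. max_cost n k a d \<alpha>)) ` tuples k (arcs G))"

definition price_of_uncorrelation ::
    "('v, 'e) pre_digraph \<Rightarrow> 'v \<Rightarrow> 'v \<Rightarrow> nat \<Rightarrow> nat \<Rightarrow> real \<Rightarrow> real" where
  "price_of_uncorrelation G s t n k \<alpha> =
     min_over (F G n k \<alpha>) (uncorrelated G s t n) / min_over (F G n k \<alpha>) (correlated G s t n)"

definition edge_disjoint_families ::
    "('v, 'e) pre_digraph \<Rightarrow> 'v \<Rightarrow> 'v \<Rightarrow> 'e set set set" where
  "edge_disjoint_families G s t = {M. M \<subseteq> st_paths G s t \<and> disjoint M}"

definition MF :: "('v, 'e) pre_digraph \<Rightarrow> 'v \<Rightarrow> 'v \<Rightarrow> 'e set set set" where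
  "MF G s t = {M \<in> edge_disjoint_families G s t.
     \<forall>M' \<in> edge_disjoint_families G s t. M \<subseteq> M' \<longrightarrow> M' = M}"

text \<open>Every ordering by nondecreasing length is admitted, so ties may be broken arbitrarily.\<close>

definition prefixes_of :: "'e set set \<Rightarrow> 'e set set set" where
  "prefixes_of M = {set (take i ps) |i ps.
     set ps = M \<and> distinct ps \<and> sorted (map card ps) \<and> 1 \<le> i \<and> i \<le> length ps}"

definition uniform_strategies ::
    "('v, 'e) pre_digraph \<Rightarrow> 'v \<Rightarrow> 'v \<Rightarrow> nat \<Rightarrow> (nat \<Rightarrow> 'e set) pmf set" where
  "uniform_strategies G s t n =
     {product_dist n (\<lambda>_. pmf_of_set P) |P. \<exists>M \<in> MF G s t. P \<in> prefixes_of M}"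

definition uniform_price_of_uncorrelation ::
    "('v, 'e) pre_digraph \<Rightarrow> 'v \<Rightarrow> 'v \<Rightarrow> nat \<Rightarrow> nat \<Rightarrow> real \<Rightarrow> real" where
  "uniform_price_of_uncorrelation G s t n k \<alpha> =
     min_over (F G n k \<alpha>) (uniform_strategies G s t n) /
     min_over (F G 1 k \<alpha>) (uniform_strategies G s t 1)"

definition E_ln :: "nat \<Rightarrow> nat \<Rightarrow> real" where
  "E_ln l n = real l * (1 - (1 - 1 / real l) ^ n)"

end

theory Submission
  imports Defs "HOL-Real_Asymp.Real_Asymp"
begin

text \<open>
  Write \<open>A = \<alpha> k / m\<^sub>c\<close> and \<open>E = E_ln m\<^sub>c n\<close>. If all interceptors stand on one arc \<open>e\<close>, the MAX cost is at
  least \<open>|p\<^sub>m\<^sub>i\<^sub>n|\<close> plus \<open>\<alpha> k\<close> times the indicator that some agent uses \<open>e\<close>. For \<open>e\<close> in a minimum cut,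
  averaging yields the lower bound \<open>|p\<^sub>m\<^sub>i\<^sub>n| + A\<close> on the correlated minimum, and AM-GM yields the lower bound
  \<open>|p\<^sub>m\<^sub>i\<^sub>n| + A E\<close> on the uncorrelated one. Conversely, by Menger's theorem there are \<open>m\<^sub>c\<close> pairwise disjoint
  paths, and the uniform strategy on them costs at most \<open>|p\<^sub>m\<^sub>a\<^sub>x| + A E\<close>. One agent's uniform strategy, copied
  to all agents, is a correlated one, so the correlated minimum is at most \<open>|p\<^sub>m\<^sub>a\<^sub>x| + A\<close>. Finally, the
  uncorrelated minimum is at most \<open>n\<close> times the correlated one (all agents imitate the first agent
  independently) and at most \<open>|p\<^sub>m\<^sub>i\<^sub>n| + m\<^sub>c A\<close> (all agents take a shortest path). All parts of the theorem
  follow from these inequalities by arithmetic.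
\<close>

section \<open>Arc-disjoint paths and minimum cuts\<close>

context pre_digraph
begin

text \<open>The net outflow at \<open>v\<close> when each arc of \<open>X\<close> carries one unit.
  Arc sets thus play the part of integral flows with unit capacities.\<close>

definition excess :: "'b set \<Rightarrow> 'a \<Rightarrow> int" where
  "excess X v = (\<Sum>e\<in>X. of_bool (tail G e = v) - of_bool (head G e = v))"

lemma cas_telescope:
  "cas u p v \<Longrightarrow>
    (\<Sum>e\<leftarrow>p. of_bool (tail G e = x) - of_bool (head G e = x) :: int)
      = of_bool (u = x) - of_bool (v = x)"
  by (induction u p v rule: cas.induct) auto

lemma excess_apath:
  assumes "apath u p v"
  shows "excess (set p) x = of_bool (u = x) - of_bool (v = x)"
proof -
  have "cas u p v" and d: "distinct (awalk_verts u p)"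
    using assms by (auto simp: apath_def awalk_def)
  \<comment> \<open>Distinct vertices force distinct arcs, so the telescoping sum over the list
    becomes a sum over \<open>set p\<close>.\<close>
  moreover have "distinct p"
    using d by (cases "p = []") (auto simp: awalk_verts_conv distinct_map)
  ultimately show ?thesis
    unfolding excess_def using cas_telescope[of u p v x] by (simp add: sum_list_distinct_conv_sum_set)
qed

lemma cas_crosses:
  assumes "cas u p v" "u \<in> S" "v \<notin> S"
  shows "\<exists>e\<in>set p. tail G e \<in> S \<and> head G e \<notin> S"
  using assms by (induction u p v rule: cas.induct) auto

lemma st_paths_meet_cut:
  assumes "p \<in> st_paths G s t" "s \<in> S" "t \<notin> S"
  shows "p \<inter> cut_arcs G S \<noteq> {}"
proof -
  from assms(1) obtain q where q: "p = set q" "awalk s q t"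
    by (auto simp: st_paths_def apath_def)
  then obtain e where "e \<in> set q" "tail G e \<in> S" "head G e \<notin> S"
    using cas_crosses[of s q t S] assms by (auto simp: awalk_def)
  with q show ?thesis
    by (auto simp: cut_arcs_def awalk_def)
qed

end

context fin_digraph
begin

text \<open>After exchanging the sums, an arc with both ends in \<open>S\<close> contributes
  \<open>1 - 1 = 0\<close>; only arcs across the boundary survive.\<close>

lemma sum_excess:
  assumes "X \<subseteq> arcs G" "S \<subseteq> verts G"
  shows "(\<Sum>v\<in>S. excess X v) =
    int (card {e\<in>X. tail G e \<in> S \<and> head G e \<notin> S}) - int (card {e\<in>X. head G e \<in> S \<and> tail G e \<notin> S})"
proof -
  have fin: "finite X" "finite S"
    using assms by (auto intro: finite_subset)
  have "(\<Sum>v\<in>S. excess X v) =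
      (\<Sum>e\<in>X. \<Sum>v\<in>S. of_bool (tail G e = v) - of_bool (head G e = v))"
    unfolding excess_def by (rule sum.swap)
  also have "\<dots> = (\<Sum>e\<in>X. of_bool (tail G e \<in> S) - of_bool (head G e \<in> S))"
    using fin by (intro sum.cong refl) (simp add: sum_subtractf of_bool_def)
  also have "\<dots> = (\<Sum>e\<in>X. of_bool (tail G e \<in> S \<and> head G e \<notin> S)
      - of_bool (head G e \<in> S \<and> tail G e \<notin> S))"
    by (intro sum.cong) auto
  also have "\<dots> = int (card {e\<in>X. tail G e \<in> S \<and> head G e \<notin> S})
      - int (card {e\<in>X. head G e \<in> S \<and> tail G e \<notin> S})"
    using fin by (simp add: sum_subtractf of_bool_def sum.If_cases Int_def)
  finally show ?thesis .
qed

section \<open>Flows as arc sets: augmentation and decomposition\<close>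

definition flow :: "'a \<Rightarrow> 'a \<Rightarrow> 'b set \<Rightarrow> bool" where
  "flow s t X \<longleftrightarrow> X \<subseteq> arcs G \<and> (\<forall>v\<in>verts G - {s, t}. excess X v = 0)"

text \<open>Conservation makes \<open>s\<close> the only vertex of \<open>S\<close> that contributes
  to the summed excess.\<close>

lemma flow_cut_value:
  assumes "flow s t X" "S \<subseteq> verts G" "s \<in> S" "t \<notin> S"
  shows "excess X s =
    int (card {e\<in>X. tail G e \<in> S \<and> head G e \<notin> S}) - int (card {e\<in>X. head G e \<in> S \<and> tail G e \<notin> S})"
proof -
  have "finite S"
    using assms(2) by (auto intro: finite_subset)
  have "(\<Sum>v\<in>S. excess X v) = (\<Sum>v\<in>{s}. excess X v)"
    using assms \<open>finite S\<close> by (intro sum.mono_neutral_right) (auto simp: flow_def)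
  with sum_excess[of X S] assms show ?thesis
    by (simp add: flow_def)
qed

text \<open>If \<open>t\<close> were unreachable from \<open>s\<close> inside \<open>X\<close>, no
  arc of \<open>X\<close> would leave the reachable set, and the value of the flow across this cut
  would be at most zero.\<close>

lemma flow_supports_apath:
  assumes "flow s t X" "excess X s > 0" "s \<in> verts G"
  shows "\<exists>p. apath s p t \<and> set p \<subseteq> X"
proof -
  have X: "X \<subseteq> arcs G"
    using assms by (simp add: flow_def)
  let ?H = "\<lparr>verts = verts G, arcs = X, tail = tail G, head = head G\<rparr>"
  interpret H: wf_digraph ?H
    using X by unfold_locales auto
  define S where "S = {v \<in> verts G. \<exists>p. H.awalk s p v}"
  have "\<exists>p. H.awalk s p t"
  proof (rule ccontr)
    assume "\<nexists>p. H.awalk s p t"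
    have s: "s \<in> S"
      using assms by (auto intro!: exI[of _ "[]"] simp: S_def H.awalk_Nil_iff)
    have out: "{e\<in>X. tail G e \<in> S \<and> head G e \<notin> S} = {}"
    proof -
      have "\<exists>q. H.awalk s q (head G e)" if "e \<in> X" "H.awalk s p (tail G e)" for e p
        by (intro exI[of _ "p @ [e]"] H.awalk_appendI[OF that(2)])
          (use H.arc_implies_awalk[of e] that(1) in simp)
      with X show ?thesis by (auto simp: S_def)
    qed
    have "S \<subseteq> verts G" "t \<notin> S"
      using \<open>\<nexists>p. H.awalk s p t\<close> by (auto simp: S_def)
    with flow_cut_value[OF assms(1), of S] s assms(2) show False
      unfolding out by simp
  qed
  then obtain p where "H.apath s p t"
    using H.apath_awalk_to_apath by meson
  \<comment> \<open>The subgraph \<open>?H\<close> keeps tails and heads, so its walks are walks of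
    \<open>G\<close>.\<close>
  moreover have "H.cas u p v = cas u p v" for u p v
    by (induction u p v rule: cas.induct) auto
  moreover have "H.awalk_verts u p = awalk_verts u p" for u p
    by (induction p arbitrary: u) auto
  ultimately have "apath s p t \<and> set p \<subseteq> X"
    using X by (auto simp: apath_def awalk_def H.apath_def H.awalk_def)
  then show ?thesis by blast
qed

text \<open>
  A residual path is a path in the digraph in which the arcs of \<open>X\<close> are reversed.
\<close>

lemma flow_augment:
  assumes "flow s t X" "s \<in> verts G" "s \<noteq> t"
    and cut: "\<And>S. S \<subseteq> verts G \<Longrightarrow> s \<in> S \<Longrightarrow> t \<notin> S \<Longrightarrow> excess X s < int (card (cut_arcs G S))"
  shows "\<exists>Y. flow s t Y \<and> excess Y s = excess X s + 1"
proof -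
  have X: "X \<subseteq> arcs G"
    using assms by (simp add: flow_def)
  let ?tl = "\<lambda>e. if e \<in> X then head G e else tail G e"
  let ?hd = "\<lambda>e. if e \<in> X then tail G e else head G e"
  let ?H = "\<lparr>verts = verts G, arcs = arcs G, tail = ?tl, head = ?hd\<rparr>"
  interpret H: wf_digraph ?H
    by unfold_locales auto
  define S where "S = {v \<in> verts G. \<exists>p. H.awalk s p v}"
  have "\<exists>p. H.awalk s p t"
  proof (rule ccontr)
    assume not: "\<nexists>p. H.awalk s p t"
    have S: "S \<subseteq> verts G" "s \<in> S" "t \<notin> S"
      using assms not by (auto intro!: exI[of _ "[]"] simp: S_def H.awalk_Nil_iff)
    have step: "\<exists>q. H.awalk s q (?hd e)" if "e \<in> arcs G" "H.awalk s p (?tl e)" for e p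
      by (intro exI[of _ "p @ [e]"] H.awalk_appendI[OF that(2)])
        (use H.arc_implies_awalk[of e] that(1) in simp)
    \<comment> \<open>An arc of \<open>G\<close> leaving the reachable set \<open>S\<close> must lie
      in \<open>X\<close>, for otherwise it could be traversed; an arc of \<open>X\<close> entering
      \<open>S\<close> could be traversed backwards. Hence \<open>X\<close> fills the whole cut,
      against \<open>cut\<close>.\<close>
    have out: "{e\<in>X. tail G e \<in> S \<and> head G e \<notin> S} = cut_arcs G S"
    proof -
      have "e \<in> X" if "e \<in> arcs G" "H.awalk s p (tail G e)" "head G e \<notin> S" for e p
        by (rule ccontr) (use step[of e p] that in \<open>simp add: S_def\<close>)
      with X show ?thesis by (auto simp: S_def cut_arcs_def)
    qed
    have into: "{e\<in>X. head G e \<in> S \<and> tail G e \<notin> S} = {}"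
    proof -
      have "tail G e \<in> S" if "e \<in> X" "H.awalk s p (head G e)" for e p
        using step[of e p] that X by (simp add: S_def subset_iff)
      then show ?thesis by (auto simp: S_def)
    qed
    show False
      using flow_cut_value[OF assms(1) S] cut[OF S] unfolding out into by simp
  qed
  then obtain p where p: "H.apath s p t"
    using H.apath_awalk_to_apath by meson
  then have parcs: "set p \<subseteq> arcs G"
    by (auto simp: H.apath_def H.awalk_def)
  \<comment> \<open>Augmentation along the residual path: arcs used backwards leave
    \<open>X\<close>, the others join it.\<close>
  let ?Y = "(X - set p) \<union> (set p - X)"
  have ex: "excess ?Y v = excess X v + (of_bool (s = v) - of_bool (t = v))" for v
  proof -
    define g :: "'b \<Rightarrow> int" where "g = (\<lambda>e. of_bool (tail G e = v) - of_bool (head G e = v))"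
    have fin: "finite X"
      using X by (auto intro: finite_subset)
    \<comment> \<open>The telescoping identity for \<open>p\<close> in \<open>?H\<close>, where each
      arc of \<open>X\<close> counts with the opposite sign.\<close>
    have "of_bool (s = v) - of_bool (t = v) =
        (\<Sum>e\<in>set p. of_bool (?tl e = v) - of_bool (?hd e = v) :: int)"
      using H.excess_apath[OF p, of v] unfolding H.excess_def
      by (simp only: pre_digraph.select_convs)
    also have "\<dots> = (\<Sum>e\<in>set p. if e \<in> X then - g e else g e)"
      by (intro sum.cong) (auto simp: g_def)
    also have "\<dots> = sum g (set p - X) - sum g (set p \<inter> X)"
      by (simp add: sum.If_cases sum_negf Diff_eq)
    finally have p_sum: "of_bool (s = v) - of_bool (t = v) = sum g (set p - X) - sum g (set p \<inter> X)" .
    have exg: "excess Z v = sum g Z" for Z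
      by (simp add: excess_def g_def)
    have "sum g ?Y = sum g (X - set p) + sum g (set p - X)"
      using fin by (intro sum.union_disjoint) auto
    moreover have "sum g X = sum g (set p \<inter> X) + sum g (X - set p)"
      using fin by (subst sum.Int_Diff[of X g "set p"]) (auto simp: Int_commute)
    ultimately show ?thesis
      unfolding exg p_sum by simp
  qed
  have "flow s t ?Y"
    using assms(1) parcs unfolding flow_def by (auto simp: ex)
  moreover have "excess ?Y s = excess X s + 1"
    using \<open>s \<noteq> t\<close> by (simp add: ex)
  ultimately show ?thesis by blast
qed

text \<open>The Ford-Fulkerson argument: starting from the empty flow, augmentation succeeds as long
  as the value lies below every cut size.\<close>

lemma flow_min_cut:
  assumes "s \<in> verts G" "s \<noteq> t"
    and "\<And>S. S \<subseteq> verts G \<Longrightarrow> s \<in> S \<Longrightarrow> t \<notin> S \<Longrightarrow> m \<le> card (cut_arcs G S)"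
  shows "\<exists>X. flow s t X \<and> excess X s = int m"
  using assms(3)
proof (induction m)
  case 0
  have "flow s t {}" "excess {} s = int 0"
    by (auto simp: flow_def excess_def)
  then show ?case by blast
next
  case (Suc m)
  have "\<exists>X. flow s t X \<and> excess X s = int m"
    by (rule Suc.IH) (rule Suc_leD[OF Suc.prems])
  then obtain X where X: "flow s t X" "excess X s = int m"
    by blast
  have "excess X s < int (card (cut_arcs G S))" if "S \<subseteq> verts G" "s \<in> S" "t \<notin> S" for S
    using Suc.prems[OF that] X(2) by simp
  with flow_augment[OF X(1) assms(1,2)] obtain Y where "flow s t Y" "excess Y s = excess X s + 1"
    by blast
  with X(2) show ?case
    by (intro exI[of _ Y]) simp
qed

text \<open>Removing a path inside \<open>X\<close> preserves conservation and lowers the value by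
  one. The clause \<open>\<Union>M \<subseteq> X\<close> lets the induction hypothesis guarantee
  disjointness from the removed path.\<close>

lemma flow_decompose:
  assumes "flow s t X" "excess X s = int m" "s \<in> verts G" "s \<noteq> t"
  shows "\<exists>M. M \<subseteq> st_paths G s t \<and> disjoint M \<and> finite M \<and> card M = m \<and> \<Union>M \<subseteq> X"
  using assms(1,2)
proof (induction m arbitrary: X)
  case 0
  show ?case by (intro exI[of _ "{}"] conjI) simp_all
next
  case (Suc m)
  then obtain p where p: "apath s p t" "set p \<subseteq> X"
    using flow_supports_apath[of s t X] assms(3) by auto
  have "p \<noteq> []"
    using p(1) \<open>s \<noteq> t\<close> by (auto simp: apath_Nil_iff)
  have X: "finite X"
    using Suc.prems by (auto simp: flow_def intro: finite_subset)
  have ex: "excess (X - set p) v = excess X v - (of_bool (s = v) - of_bool (t = v))" for v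
    using X p(2) excess_apath[OF p(1), of v] by (simp add: excess_def sum_diff)
  have "flow s t (X - set p)" "excess (X - set p) s = int m"
    using Suc.prems \<open>s \<noteq> t\<close> by (auto simp: flow_def ex)
  from Suc.IH[OF this] obtain M where
    M: "M \<subseteq> st_paths G s t" "disjoint M" "finite M" "card M = m" "\<Union>M \<subseteq> X - set p"
    by blast
  \<comment> \<open>Members of \<open>M\<close> avoid \<open>set p\<close>, and only the empty set
    avoids itself.\<close>
  have "set p \<notin> M"
    using M(5) \<open>p \<noteq> []\<close> by (cases p) auto
  moreover have "disjoint (insert (set p) M)"
    using M(2,5) unfolding disjoint_def by blast
  moreover have "set p \<in> st_paths G s t"
    using p by (auto simp: st_paths_def)
  ultimately show ?case
    using M p by (intro exI[of _ "insert (set p) M"]) auto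
qed

end

section \<open>Menger's theorem and maximal families of disjoint paths\<close>

context st_dag
begin

abbreviation "m_c \<equiv> min_cut G s t"

lemma finite_cuts: "finite {card (cut_arcs G S) |S. S \<subseteq> verts G \<and> s \<in> S \<and> t \<notin> S}"
proof -
  have "{card (cut_arcs G S) |S. S \<subseteq> verts G \<and> s \<in> S \<and> t \<notin> S} \<subseteq> (\<lambda>S. card (cut_arcs G S)) ` Pow (verts G)"
    by blast
  then show ?thesis
    by (rule finite_subset) simp
qed

lemma min_cut_le: "S \<subseteq> verts G \<Longrightarrow> s \<in> S \<Longrightarrow> t \<notin> S \<Longrightarrow> m_c \<le> card (cut_arcs G S)"
  unfolding min_cut_def by (rule Min_le[OF finite_cuts]) blast

lemma min_cut_attained:
  obtains S where "S \<subseteq> verts G" "s \<in> S" "t \<notin> S" "card (cut_arcs G S) = m_c"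
proof -
  have "m_c \<in> {card (cut_arcs G S) |S. S \<subseteq> verts G \<and> s \<in> S \<and> t \<notin> S}"
    unfolding min_cut_def
    using source_in_verts sink_in_verts source_neq_sink
    by (intro Min_in finite_cuts) (auto intro!: exI[of _ "{s}"])
  then show ?thesis
    using that by auto
qed

lemma st_path_subset_arcs: "p \<in> st_paths G s t \<Longrightarrow> p \<subseteq> arcs G"
  by (auto simp: st_paths_def apath_def awalk_def)

lemma finite_st_paths: "finite (st_paths G s t)"
  by (rule finite_subset[of _ "Pow (arcs G)"]) (auto dest: st_path_subset_arcs)

lemma st_paths_nonempty: "st_paths G s t \<noteq> {}"
  using arcs_nonempty arc_on_st_path by (fastforce simp: st_paths_def)

lemma card_path_bounds:
  assumes "p \<in> st_paths G s t"
  shows "p_min G s t \<le> card p" "card p \<le> p_max G s t"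
  using assms finite_st_paths by (auto simp: p_min_def p_max_def)

lemma shortest_path:
  obtains p where "p \<in> st_paths G s t" "card p = p_min G s t"
proof -
  have "p_min G s t \<in> card ` st_paths G s t"
    unfolding p_min_def using finite_st_paths st_paths_nonempty by (intro Min_in) auto
  then show ?thesis
    using that by auto
qed

lemma min_cut_pos: "m_c \<ge> 1"
proof -
  obtain S where S: "S \<subseteq> verts G" "s \<in> S" "t \<notin> S" "card (cut_arcs G S) = m_c"
    by (rule min_cut_attained)
  obtain p where "p \<in> st_paths G s t"
    using st_paths_nonempty by blast
  then have "cut_arcs G S \<noteq> {}"
    using st_paths_meet_cut S by blast
  moreover have "finite (cut_arcs G S)"
    by (simp add: cut_arcs_def)
  ultimately show ?thesis
    using S(4) card_0_eq by fastforce
qed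

text \<open>Every path owns an arc of a minimum cut, and disjoint paths own different arcs.\<close>

lemma card_edge_disjoint_family_le:
  assumes "M \<in> edge_disjoint_families G s t"
  shows "card M \<le> m_c"
proof -
  obtain S where S: "S \<subseteq> verts G" "s \<in> S" "t \<notin> S" "card (cut_arcs G S) = m_c"
    by (rule min_cut_attained)
  have M: "M \<subseteq> st_paths G s t" "disjoint M"
    using assms by (auto simp: edge_disjoint_families_def)
  have "\<exists>f. \<forall>p\<in>M. f p \<in> p \<inter> cut_arcs G S"
    using st_paths_meet_cut S M(1) by (intro bchoice) blast
  then obtain f where f: "\<And>p. p \<in> M \<Longrightarrow> f p \<in> p \<inter> cut_arcs G S"
    by blast
  have "inj_on f M"
  proof (rule inj_onI)
    fix p q assume "p \<in> M" "q \<in> M" "f p = f q"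
    with f[of p] f[of q] M(2) show "p = q"
      unfolding disjoint_def by fastforce
  qed
  then have "card M \<le> card (cut_arcs G S)"
    using f by (intro card_inj_on_le[of f]) (auto simp: cut_arcs_def)
  with S show ?thesis by simp
qed

lemma menger:
  obtains M where "M \<in> edge_disjoint_families G s t" "finite M" "card M = m_c"
proof -
  obtain X where "flow s t X" "excess X s = int m_c"
    using flow_min_cut[of s t m_c] source_in_verts source_neq_sink min_cut_le by blast
  then show ?thesis
    using flow_decompose[of s t X m_c] source_in_verts source_neq_sink that
    by (auto simp: edge_disjoint_families_def)
qed

text \<open>A disjoint family of \<open>m_c\<close> paths has the largest possible size, so it is
  inclusion-maximal; sorted by length it is the full prefix of itself. The uniform distribution on
  it is therefore an admissible uniform strategy.\<close>

lemma menger_MF: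
  obtains M where "M \<in> MF G s t" "M \<in> prefixes_of M" "finite M" "card M = m_c" "disjoint M"
    "M \<subseteq> st_paths G s t"
proof -
  obtain M where M: "M \<in> edge_disjoint_families G s t" "finite M" "card M = m_c"
    by (rule menger)
  have "M' = M" if "M' \<in> edge_disjoint_families G s t" "M \<subseteq> M'" for M'
  proof -
    have "finite M'"
      using that finite_st_paths by (auto simp: edge_disjoint_families_def intro: finite_subset)
    then show ?thesis
      using card_edge_disjoint_family_le[OF that(1)] that(2) M(3) card_seteq[of M' M] by simp
  qed
  with M(1) have "M \<in> MF G s t"
    by (auto simp: MF_def)
  moreover have "M \<in> prefixes_of M"
  proof -
    obtain xs where "set xs = M" "distinct xs"
      using finite_distinct_list[OF M(2)] by blast
    moreover have "M \<noteq> {}"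
      using M(3) min_cut_pos by auto
    ultimately have "set (sort_key card xs) = M" "distinct (sort_key card xs)" "length xs \<ge> 1"
      by (auto simp: Suc_le_eq)
    then show ?thesis
      unfolding prefixes_of_def
      by (intro CollectI exI[of _ "length xs"] exI[of _ "sort_key card xs"]) simp
  qed
  ultimately show ?thesis
    using M that by (auto simp: edge_disjoint_families_def)
qed

end

section \<open>Attained minima\<close>

text \<open>Since \<open>min_over\<close> is a \<open>LEAST\<close>, every fact about it rests on
  this existence statement, which is proved below for each class of strategies.\<close>

definition attains_min :: "('a \<Rightarrow> real) \<Rightarrow> 'a set \<Rightarrow> bool" where
  "attains_min f S \<longleftrightarrow> (\<exists>x\<in>S. \<forall>y\<in>S. f x \<le> f y)"

lemma min_over_attained:
  assumes "attains_min f S"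
  obtains x where "x \<in> S" "min_over f S = f x" "\<And>y. y \<in> S \<Longrightarrow> f x \<le> f y"
proof -
  obtain x where x: "x \<in> S" "\<And>y. y \<in> S \<Longrightarrow> f x \<le> f y"
    using assms by (auto simp: attains_min_def)
  then have "min_over f S = f x"
    unfolding min_over_def by (intro Least_equality) auto
  with x that show ?thesis by blast
qed

lemma min_over_le: "attains_min f S \<Longrightarrow> y \<in> S \<Longrightarrow> min_over f S \<le> f y"
  by (metis min_over_attained)

lemma min_over_ge:
  assumes "attains_min f S" "\<And>x. x \<in> S \<Longrightarrow> c \<le> f x"
  shows "c \<le> min_over f S"
  by (metis assms min_over_attained)

lemma attains_min_finite:
  assumes "finite S" "S \<noteq> {}"
  shows "attains_min f S"
  using ex_is_arg_min_if_finite[OF assms, of f]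
  by (auto simp: attains_min_def is_arg_min_linorder)

text \<open>The extreme value theorem is applied in a function space: \<open>g\<close> sends
  strategies to their mass functions, and \<open>f\<close> factors through \<open>g\<close>.\<close>

lemma attains_min_compact:
  assumes "compact (g ` S)" "S \<noteq> {}" "continuous_on (g ` S) h" "\<And>x. x \<in> S \<Longrightarrow> f x = h (g x)"
  shows "attains_min f S"
  using continuous_attains_inf[OF assms(1) _ assms(3)] assms(2,4)
  by (auto simp: attains_min_def)

lemma continuous_on_Max_image:
  fixes f :: "'i \<Rightarrow> 'a::topological_space \<Rightarrow> real"
  assumes "finite I" "I \<noteq> {}" "\<And>i. i \<in> I \<Longrightarrow> continuous_on A (f i)"
  shows "continuous_on A (\<lambda>x. Max ((\<lambda>i. f i x) ` I))"
  using assms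
proof (induction I rule: finite_ne_induct)
  case (insert i I)
  then have "(\<lambda>x. Max ((\<lambda>i. f i x) ` insert i I)) = (\<lambda>x. max (f i x) (Max ((\<lambda>i. f i x) ` I)))"
    by auto
  with insert show ?case
    by (auto intro!: continuous_on_max)
qed auto

section \<open>Compactness of sets of distributions\<close>

text \<open>Tychonoff's theorem, carried over to the topology on the function type.\<close>

lemma compact_PiE_UNIV:
  fixes K :: "'a \<Rightarrow> 'b::topological_space set"
  assumes "\<And>i. compact (K i)"
  shows "compact (PiE UNIV K)"
proof -
  have "compactin (product_topology (\<lambda>_. euclidean) UNIV) (PiE UNIV K)"
    using assms by (subst compactin_PiE) auto
  then show ?thesis
    by (simp add: euclidean_product_topology)
qed

text \<open>The mass functions form the closed subset of total mass one in a compact box whose sides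
  outside \<open>X\<close> are \<open>{0}\<close>.\<close>

lemma compact_pmf_Delta:
  assumes "finite X"
  shows "compact (pmf ` Delta X)"
proof -
  let ?B = "PiE UNIV (\<lambda>x. if x \<in> X then {0..1} else {0::real})"
  have "compact (?B \<inter> {f. sum f X = 1})"
    by (intro compact_Int_closed compact_PiE_UNIV closed_Collect_eq continuous_intros
        continuous_on_product_coordinates) auto
  moreover have "pmf ` Delta X = ?B \<inter> {f. sum f X = 1}"
  proof (intro equalityI subsetI)
    fix f assume "f \<in> pmf ` Delta X"
    then obtain \<sigma> where "f = pmf \<sigma>" "set_pmf \<sigma> \<subseteq> X"
      by (auto simp: Delta_def)
    with assms show "f \<in> ?B \<inter> {f. sum f X = 1}"
      by (auto simp: pmf_le_1 sum_pmf_eq_1 set_pmf_iff)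
  next
    fix f assume f: "f \<in> ?B \<inter> {f. sum f X = 1}"
    then have rng: "f x \<in> (if x \<in> X then {0..1} else {0})" for x
      by (auto simp: PiE_iff)
    have nonneg: "0 \<le> f x" and out: "x \<notin> X \<Longrightarrow> f x = 0" for x
      using rng[of x] by (auto split: if_splits)
    \<comment> \<open>This normalisation is what turns \<open>f\<close> into a distribution by
      \<open>embed_pmf\<close>.\<close>
    have "(\<integral>\<^sup>+x. ennreal (f x) \<partial>count_space UNIV) = (\<Sum>x\<in>X. ennreal (f x))"
      using assms out by (intro nn_integral_count_space') auto
    also have "\<dots> = 1"
      using f nonneg by (simp add: sum_ennreal)
    finally have int: "(\<integral>\<^sup>+x. ennreal (f x) \<partial>count_space UNIV) = 1" .
    have "embed_pmf f \<in> Delta X"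
      using out by (auto simp: Delta_def set_embed_pmf[OF nonneg int])
    moreover have "pmf (embed_pmf f) = f"
      by (simp add: fun_eq_iff pmf_embed_pmf[OF nonneg int])
    ultimately show "f \<in> pmf ` Delta X"
      by (metis imageI)
  qed
  ultimately show ?thesis by simp
qed

section \<open>Product distributions\<close>

lemma product_dist_in_Delta:
  "(\<And>i. i < n \<Longrightarrow> \<sigma> i \<in> Delta X) \<Longrightarrow> product_dist n \<sigma> \<in> Delta (tuples n X)"
  unfolding product_dist_def
  by (fastforce simp: set_Pi_pmf PiE_dflt_def Delta_def PiE_iff extensional_def)

lemma product_dist_cong:
  "(\<And>i. i < n \<Longrightarrow> \<sigma> i = \<tau> i) \<Longrightarrow> product_dist n \<sigma> = product_dist n \<tau>"
  unfolding product_dist_def by (intro Pi_pmf_cong) auto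

lemma product_dist_in_uncorrelated:
  assumes "\<And>i. i < n \<Longrightarrow> \<sigma> i \<in> Delta (st_paths G s t)"
  shows "product_dist n \<sigma> \<in> uncorrelated G s t n"
proof -
  \<comment> \<open>Only coordinates below \<open>n\<close> matter; \<open>restrict\<close> gives
    the extensional representative that \<open>tuples\<close> demands.\<close>
  have "product_dist n \<sigma> = product_dist n (restrict \<sigma> {..<n})"
    by (intro product_dist_cong) auto
  moreover have "restrict \<sigma> {..<n} \<in> tuples n (Delta (st_paths G s t))"
    using assms by auto
  ultimately show ?thesis
    unfolding uncorrelated_def by blast
qed

text \<open>By independence, the probability that no coordinate satisfies \<open>Q\<close> is a
  product.\<close>

lemma prob_product_dist_ex:
  "measure_pmf.prob (product_dist n \<sigma>) {a. \<exists>i<n. Q (a i)} =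
    1 - (\<Prod>i<n. 1 - measure_pmf.prob (\<sigma> i) {p. Q p})"
proof -
  let ?N = "Pi {..<n} (\<lambda>_. {p. \<not> Q p})"
  have "{a. \<exists>i<n. Q (a i)} = - ?N"
    by (auto simp: Pi_iff)
  then have "measure_pmf.prob (product_dist n \<sigma>) {a. \<exists>i<n. Q (a i)}
      = 1 - measure_pmf.prob (product_dist n \<sigma>) ?N"
    using measure_pmf.prob_compl[of ?N "product_dist n \<sigma>"] by (simp add: Compl_eq_Diff_UNIV)
  also have "measure_pmf.prob (product_dist n \<sigma>) ?N
      = (\<Prod>i<n. measure_pmf.prob (\<sigma> i) {p. \<not> Q p})"
    unfolding product_dist_def by (intro measure_Pi_pmf_Pi) simp
  also have "\<dots> = (\<Prod>i<n. 1 - measure_pmf.prob (\<sigma> i) {p. Q p})"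
  proof (intro prod.cong refl)
    fix i
    have "{p. \<not> Q p} = UNIV - {p. Q p}" by auto
    then show "measure_pmf.prob (\<sigma> i) {p. \<not> Q p} = 1 - measure_pmf.prob (\<sigma> i) {p. Q p}"
      using measure_pmf.prob_compl[of "{p. Q p}" "\<sigma> i"] by simp
  qed
  finally show ?thesis .
qed

text \<open>The union bound applied to an almost sure event. With \<open>C\<close> a cut, it says
  that the hitting probabilities of its arcs sum to at least one.\<close>

lemma sum_prob_ge_1:
  assumes "\<sigma> \<in> Delta X" "finite C" "\<And>a. a \<in> X \<Longrightarrow> \<exists>e\<in>C. Q e a"
  shows "1 \<le> (\<Sum>e\<in>C. measure_pmf.prob \<sigma> {a. Q e a})"
proof -
  have "1 = measure_pmf.prob \<sigma> (\<Union>e\<in>C. {a. Q e a})"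
    using assms by (intro sym[OF measure_pmf.prob_eq_1[THEN iffD2]])
      (auto simp: AE_measure_pmf_iff Delta_def)
  also have "\<dots> \<le> (\<Sum>e\<in>C. measure_pmf.prob \<sigma> {a. Q e a})"
    using assms by (intro measure_UNION_le) auto
  finally show ?thesis .
qed

lemma expectation_mono_Delta:
  fixes f g :: "'a \<Rightarrow> real"
  assumes "\<sigma> \<in> Delta X" "finite X" "\<And>a. a \<in> X \<Longrightarrow> f a \<le> g a"
  shows "measure_pmf.expectation \<sigma> f \<le> measure_pmf.expectation \<sigma> g"
proof -
  have "finite (set_pmf \<sigma>)"
    using assms by (auto simp: Delta_def intro: finite_subset)
  with assms show ?thesis
    by (intro integral_mono_AE) (auto simp: AE_measure_pmf_iff Delta_def integrable_measure_pmf_finite)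
qed

lemma expectation_of_bool:
  "measure_pmf.expectation \<sigma> (\<lambda>a. of_bool (Q a)) = measure_pmf.prob \<sigma> {a. Q a}"
proof -
  have "(\<lambda>a. of_bool (Q a) :: real) = indicator {a. Q a}"
    by (auto simp: indicator_def)
  then show ?thesis by simp
qed

text \<open>
  Averaging over the arcs \<open>e\<close> of a cut would not do: if all agents concentrate on one arc, the mean of the
  hitting probabilities is only \<open>1 / card C\<close>. The product over \<open>e\<close> of the probabilities of a miss is bounded
  factor by factor by AM-GM instead.
\<close>

lemma exists_large_hit_probability:
  fixes q :: "nat \<Rightarrow> 'e \<Rightarrow> real"
  assumes "finite C" "C \<noteq> {}"
    and q: "\<And>i e. i < n \<Longrightarrow> q i e \<le> 1"
    and sum: "\<And>i. i < n \<Longrightarrow> 1 \<le> (\<Sum>e\<in>C. q i e)"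
  shows "\<exists>e\<in>C. 1 - (1 - 1 / real (card C)) ^ n \<le> 1 - (\<Prod>i<n. 1 - q i e)"
proof (rule ccontr)
  let ?c = "real (card C)"
  let ?b = "1 - 1 / ?c"
  assume "\<not> ?thesis"
  then have lt: "?b ^ n < (\<Prod>i<n. 1 - q i e)" if "e \<in> C" for e
    using that by force
  have c: "?c \<ge> 1"
    using assms(1,2) by (simp add: Suc_le_eq card_gt_0_iff)
  then have b: "0 \<le> ?b" by simp
  have factor: "(\<Prod>e\<in>C. 1 - q i e) \<le> ?b ^ card C" if "i < n" for i
  proof -
    let ?P = "\<Prod>e\<in>C. 1 - q i e"
    have P: "0 \<le> ?P"
      using q[OF that] by (intro prod_nonneg) auto
    \<comment> \<open>AM-GM for the miss probabilities of a single agent, whose mean is at most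
      \<open>?b\<close> by the hypothesis \<open>sum\<close>.\<close>
    have "?P powr (1 / ?c) \<le> (\<Sum>e\<in>C. (1 - q i e) / ?c)"
      using q[OF that] assms(1,2) by (intro arith_geom_mean) auto
    also have "\<dots> = (?c - (\<Sum>e\<in>C. q i e)) / ?c"
      by (simp add: sum_subtractf flip: sum_divide_distrib)
    also have "\<dots> \<le> (?c - 1) / ?c"
      using sum[OF that] c by (intro divide_right_mono) auto
    also have "\<dots> = ?b"
      using c by (simp add: field_simps)
    finally have "(?P powr (1 / ?c)) ^ card C \<le> ?b ^ card C"
      by (intro power_mono) auto
    moreover have "(?P powr (1 / ?c)) ^ card C = ?P"
      using P c by (cases "?P = 0") (auto simp: powr_powr powr_power)
    ultimately show ?thesis by simp
  qed
  obtain e0 where "e0 \<in> C"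
    using assms(2) by blast
  \<comment> \<open>Multiplying the assumed strict bounds over \<open>C\<close> and exchanging the
    products contradicts the bounds \<open>factor\<close> for the single agents.\<close>
  have "(\<Prod>e\<in>C. ?b ^ n) < (\<Prod>e\<in>C. \<Prod>i<n. 1 - q i e)"
    using assms(1) b lt order_le_less_trans[OF zero_le_power[OF b] lt]
    by (intro prod_mono_strict[OF \<open>e0 \<in> C\<close>] conjI less_imp_le[OF lt] zero_le_power)
      (use \<open>e0 \<in> C\<close> in auto)
  also have "\<dots> = (\<Prod>i<n. \<Prod>e\<in>C. 1 - q i e)"
    by (rule prod.swap)
  also have "\<dots> \<le> (\<Prod>i<n. ?b ^ card C)"
    using factor q by (intro prod_mono) (auto intro!: prod_nonneg)
  finally show False
    by (simp add: power_mult[symmetric] mult.commute)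
qed

section \<open>Costs\<close>

definition agent_cost :: "nat \<Rightarrow> real \<Rightarrow> 'e set \<Rightarrow> (nat \<Rightarrow> 'e) \<Rightarrow> real" where
  "agent_cost k \<alpha> p d = real (card p) + \<alpha> * (\<Sum>j<k. of_bool (d j \<in> p))"

lemma max_cost_eq: "max_cost n k a d \<alpha> = Max ((\<lambda>i. agent_cost k \<alpha> (a i) d) ` {..<n})"
  by (simp add: max_cost_def agent_cost_def)

lemma agent_cost_nonneg: "\<alpha> \<ge> 0 \<Longrightarrow> 0 \<le> agent_cost k \<alpha> p d"
  by (auto simp: agent_cost_def intro!: add_nonneg_nonneg mult_nonneg_nonneg sum_nonneg)

lemma agent_cost_le_max_cost: "i < n \<Longrightarrow> agent_cost k \<alpha> (a i) d \<le> max_cost n k a d \<alpha>"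
  unfolding max_cost_eq by (intro Max_ge) auto

lemma max_cost_leI:
  "n \<ge> 1 \<Longrightarrow> (\<And>i. i < n \<Longrightarrow> agent_cost k \<alpha> (a i) d \<le> B) \<Longrightarrow> max_cost n k a d \<alpha> \<le> B"
  unfolding max_cost_eq by (subst Max_le_iff) (auto simp: lessThan_empty_iff)

lemma max_cost_const: "n \<ge> 1 \<Longrightarrow> max_cost n k (\<lambda>i\<in>{..<n}. p) d \<alpha> = agent_cost k \<alpha> p d"
  by (intro antisym max_cost_leI) (use agent_cost_le_max_cost[of 0 n k \<alpha> "\<lambda>i\<in>{..<n}. p" d] in auto)

lemma max_cost_1: "max_cost 1 k a d \<alpha> = agent_cost k \<alpha> (a 0) d"
  by (simp add: max_cost_eq lessThan_Suc)

context st_dag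
begin

abbreviation "paths \<equiv> st_paths G s t"

lemma finite_tuples_paths: "finite (tuples n paths)"
  by (intro finite_PiE) (auto intro: finite_st_paths)

lemma finite_tuples_arcs: "finite (tuples k (arcs G))"
  by (intro finite_PiE) auto

lemma tuples_arcs_nonempty: "tuples k (arcs G) \<noteq> {}"
  using arcs_nonempty by (auto simp: PiE_eq_empty_iff)

lemma F_ge:
  "d \<in> tuples k (arcs G) \<Longrightarrow> measure_pmf.expectation \<sigma> (\<lambda>a. max_cost n k a d \<alpha>) \<le> F G n k \<alpha> \<sigma>"
  unfolding F_def using finite_tuples_arcs by (intro Max_ge) auto

lemma F_le:
  assumes "\<And>d. d \<in> tuples k (arcs G) \<Longrightarrow> measure_pmf.expectation \<sigma> (\<lambda>a. max_cost n k a d \<alpha>) \<le> B"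
  shows "F G n k \<alpha> \<sigma> \<le> B"
  unfolding F_def using finite_tuples_arcs tuples_arcs_nonempty assms by (subst Max_le_iff) auto

text \<open>This form is linear in the values of the mass function, which gives the continuity
  needed for attained minima.\<close>

lemma expectation_max_cost:
  assumes "\<sigma> \<in> Delta (tuples n paths)"
  shows "measure_pmf.expectation \<sigma> (\<lambda>a. max_cost n k a d \<alpha>) =
    (\<Sum>a\<in>tuples n paths. max_cost n k a d \<alpha> * pmf \<sigma> a)"
  using assms by (intro integral_measure_pmf_real finite_tuples_paths) (auto simp: Delta_def)

lemma Delta_paths_nonempty: "\<exists>\<tau>. \<tau> \<in> Delta paths"
proof -
  obtain p where "p \<in> paths"
    using st_paths_nonempty by blast
  then have "return_pmf p \<in> Delta paths"
    by (simp add: Delta_def)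
  then show ?thesis ..
qed

section \<open>Existence of optimal strategies\<close>

text \<open>\<open>F\<close> is a maximum of finitely many linear functions of the mass function,
  over a compact set.\<close>

lemma attains_min_correlated: "attains_min (F G n k \<alpha>) (correlated G s t n)"
proof (rule attains_min_compact[where g = pmf and
      h = "\<lambda>f. Max ((\<lambda>d. \<Sum>a\<in>tuples n paths. max_cost n k a d \<alpha> * f a) ` tuples k (arcs G))"])
  show "compact (pmf ` correlated G s t n)"
    unfolding correlated_def by (intro compact_pmf_Delta finite_tuples_paths)
  obtain \<tau> where "\<tau> \<in> Delta paths"
    using Delta_paths_nonempty by blast
  then show "correlated G s t n \<noteq> {}"
    using product_dist_in_Delta[of n "\<lambda>_. \<tau>" paths] by (auto simp: correlated_def)
  show "F G n k \<alpha> \<sigma> = Max ((\<lambda>d. \<Sum>a\<in>tuples n paths. max_cost n k a d \<alpha> * pmf \<sigma> a) ` tuples k (arcs G))"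
    if "\<sigma> \<in> correlated G s t n" for \<sigma>
    using that unfolding correlated_def F_def by (simp add: expectation_max_cost)
qed (intro continuous_on_Max_image finite_tuples_arcs tuples_arcs_nonempty continuous_intros
    continuous_on_subset[OF continuous_on_product_coordinates] subset_UNIV)

text \<open>The product distributions are parametrised by their marginals; \<open>F\<close> is then
  a maximum of finitely many polynomials in the marginal probabilities.\<close>

lemma attains_min_uncorrelated: "attains_min (F G n k \<alpha>) (uncorrelated G s t n)"
proof -
  \<comment> \<open>Marginals are indexed by all naturals, so that compactness of a product over
    \<open>UNIV\<close> applies; those from \<open>n\<close> on do not influence
    \<open>product_dist n\<close>.\<close>
  let ?S = "{\<sigma> :: nat \<Rightarrow> 'e set pmf. \<forall>i. \<sigma> i \<in> Delta paths}"
  let ?g = "\<lambda>\<sigma> i. pmf (\<sigma> i) :: 'e set \<Rightarrow> real"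
  have img: "?g ` ?S = PiE UNIV (\<lambda>_. pmf ` Delta paths)"
  proof (intro equalityI subsetI)
    fix \<phi> :: "nat \<Rightarrow> 'e set \<Rightarrow> real" assume "\<phi> \<in> PiE UNIV (\<lambda>_. pmf ` Delta paths)"
    then have "\<forall>i. \<exists>\<tau>. \<tau> \<in> Delta paths \<and> \<phi> i = pmf \<tau>"
      by (auto simp: PiE_iff)
    then obtain \<sigma> where "\<And>i. \<sigma> i \<in> Delta paths \<and> \<phi> i = pmf (\<sigma> i)"
      by metis
    then show "\<phi> \<in> ?g ` ?S"
      by (intro image_eqI[of _ _ \<sigma>]) (auto simp: fun_eq_iff)
  qed auto
  have "attains_min (\<lambda>\<sigma>. F G n k \<alpha> (product_dist n \<sigma>)) ?S"
  proof (rule attains_min_compact[where g = ?g and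
        h = "\<lambda>\<phi>. Max ((\<lambda>d. \<Sum>a\<in>tuples n paths. max_cost n k a d \<alpha> * (\<Prod>i<n. \<phi> i (a i))) ` tuples k (arcs G))"])
    show "compact (?g ` ?S)"
      unfolding img by (intro compact_PiE_UNIV compact_pmf_Delta finite_st_paths)
    show "?S \<noteq> {}"
      using Delta_paths_nonempty by auto
    have "continuous_on UNIV (\<lambda>\<phi> :: nat \<Rightarrow> 'e set \<Rightarrow> real. \<phi> i p)" for i p
      by (rule continuous_on_product_then_coordinatewise[OF continuous_on_product_coordinates])
    then show "continuous_on (?g ` ?S) (\<lambda>\<phi>. Max ((\<lambda>d. \<Sum>a\<in>tuples n paths.
        max_cost n k a d \<alpha> * (\<Prod>i<n. \<phi> i (a i))) ` tuples k (arcs G)))"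
      by (intro continuous_on_Max_image finite_tuples_arcs tuples_arcs_nonempty continuous_intros)
        (auto intro: continuous_on_subset)
  next
    fix \<sigma> :: "nat \<Rightarrow> 'e set pmf" assume "\<sigma> \<in> ?S"
    then have "product_dist n \<sigma> \<in> Delta (tuples n paths)"
      by (intro product_dist_in_Delta) auto
    moreover have "pmf (product_dist n \<sigma>) a = (\<Prod>i<n. pmf (\<sigma> i) (a i))" if "a \<in> tuples n paths" for a
      unfolding product_dist_def using that by (intro pmf_Pi') (auto simp: PiE_iff extensional_def)
    ultimately show "F G n k \<alpha> (product_dist n \<sigma>) = Max ((\<lambda>d. \<Sum>a\<in>tuples n paths.
        max_cost n k a d \<alpha> * (\<Prod>i<n. pmf (\<sigma> i) (a i))) ` tuples k (arcs G))"
      unfolding F_def by (simp add: expectation_max_cost)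
  qed
  then obtain \<sigma> where \<sigma>: "\<And>i. \<sigma> i \<in> Delta paths"
    "\<And>\<tau>. (\<And>i. \<tau> i \<in> Delta paths) \<Longrightarrow> F G n k \<alpha> (product_dist n \<sigma>) \<le> F G n k \<alpha> (product_dist n \<tau>)"
    unfolding attains_min_def by blast
  have "F G n k \<alpha> (product_dist n \<sigma>) \<le> F G n k \<alpha> y" if y: "y \<in> uncorrelated G s t n" for y
  proof -
    obtain \<tau> where \<tau>: "y = product_dist n \<tau>" "\<tau> \<in> tuples n (Delta paths)"
      using y by (auto simp: uncorrelated_def)
    \<comment> \<open>From \<open>n\<close> on, \<open>\<tau>\<close> is \<open>undefined\<close>;
      the marginals of \<open>\<sigma>\<close> fill these places to give a member of
      \<open>?S\<close>.\<close>
    let ?\<tau> = "\<lambda>i. if i < n then \<tau> i else \<sigma> i"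
    have "F G n k \<alpha> (product_dist n \<sigma>) \<le> F G n k \<alpha> (product_dist n ?\<tau>)"
      using \<sigma> \<tau>(2) by (intro \<sigma>(2)) auto
    also have "product_dist n ?\<tau> = y"
      unfolding \<tau>(1) by (intro product_dist_cong) auto
    finally show ?thesis .
  qed
  moreover have "product_dist n \<sigma> \<in> uncorrelated G s t n"
    using \<sigma>(1) by (intro product_dist_in_uncorrelated) auto
  ultimately show ?thesis
    unfolding attains_min_def by blast
qed

lemma uniform_strategiesD:
  assumes "\<sigma> \<in> uniform_strategies G s t n"
  obtains P where "\<sigma> = product_dist n (\<lambda>_. pmf_of_set P)" "P \<subseteq> paths" "P \<noteq> {}" "finite P"
proof -
  obtain P M where P: "\<sigma> = product_dist n (\<lambda>_. pmf_of_set P)" "M \<in> MF G s t" "P \<in> prefixes_of M"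
    using assms by (auto simp: uniform_strategies_def)
  have "M \<subseteq> paths"
    using P(2) by (auto simp: MF_def edge_disjoint_families_def)
  moreover have "P \<subseteq> M" "P \<noteq> {}"
    using P(3) by (auto simp: prefixes_of_def dest: in_set_takeD)
  ultimately show ?thesis
    using that[of P] P(1) finite_subset[OF _ finite_st_paths, of P] by auto
qed

lemma uniform_subset_uncorrelated: "uniform_strategies G s t n \<subseteq> uncorrelated G s t n"
proof
  fix \<sigma> assume "\<sigma> \<in> uniform_strategies G s t n"
  then obtain P where P: "\<sigma> = product_dist n (\<lambda>_. pmf_of_set P)" "P \<subseteq> paths" "P \<noteq> {}" "finite P"
    by (rule uniform_strategiesD)
  then have "pmf_of_set P \<in> Delta paths"
    by (simp add: Delta_def)
  then show "\<sigma> \<in> uncorrelated G s t n"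
    unfolding P(1) by (rule product_dist_in_uncorrelated)
qed

lemma attains_min_uniform: "attains_min (F G n k \<alpha>) (uniform_strategies G s t n)"
proof (rule attains_min_finite)
  have "uniform_strategies G s t n \<subseteq> (\<lambda>P. product_dist n (\<lambda>_. pmf_of_set P)) ` Pow paths"
    by (blast elim: uniform_strategiesD)
  then show "finite (uniform_strategies G s t n)"
    by (rule finite_subset) (auto intro: finite_st_paths)
  obtain M where "M \<in> MF G s t" "M \<in> prefixes_of M"
    by (rule menger_MF)
  then show "uniform_strategies G s t n \<noteq> {}"
    by (auto simp: uniform_strategies_def)
qed

section \<open>Bounds on \<open>F\<close> in terms of hitting probabilities\<close>

lemma F_ge_hit:
  assumes "\<sigma> \<in> Delta (tuples n paths)" "e \<in> arcs G" "n \<ge> 1" "\<alpha> \<ge> 0"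
  shows "real (p_min G s t) + \<alpha> * real k * measure_pmf.prob \<sigma> {a. \<exists>i<n. e \<in> a i} \<le> F G n k \<alpha> \<sigma>"
proof -
  let ?d = "\<lambda>j\<in>{..<k}. e"
  have fin: "finite (set_pmf \<sigma>)"
    using assms(1) finite_tuples_paths[of n] by (auto simp: Delta_def intro: finite_subset)
  have "real (p_min G s t) + \<alpha> * real k * of_bool (\<exists>i<n. e \<in> a i) \<le> max_cost n k a ?d \<alpha>"
    if a: "a \<in> tuples n paths" for a
  proof -
    \<comment> \<open>An agent using \<open>e\<close> if there is one, and otherwise any
      agent.\<close>
    obtain i where i: "i < n" "(\<exists>i<n. e \<in> a i) \<longleftrightarrow> e \<in> a i"
      using assms(3) by (cases "\<exists>i<n. e \<in> a i") (force simp: Suc_le_eq)+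
    have "a i \<in> paths"
      using a i(1) by (auto simp: PiE_iff)
    then have "real (p_min G s t) \<le> real (card (a i))"
      using card_path_bounds by simp
    then have "real (p_min G s t) + \<alpha> * real k * of_bool (\<exists>i<n. e \<in> a i) \<le> agent_cost k \<alpha> (a i) ?d"
      by (simp add: i(2) agent_cost_def)
    also have "\<dots> \<le> max_cost n k a ?d \<alpha>"
      by (rule agent_cost_le_max_cost[OF i(1)])
    finally show ?thesis .
  qed
  then have "measure_pmf.expectation \<sigma> (\<lambda>a. real (p_min G s t) + \<alpha> * real k * of_bool (\<exists>i<n. e \<in> a i))
      \<le> measure_pmf.expectation \<sigma> (\<lambda>a. max_cost n k a ?d \<alpha>)"
    by (intro expectation_mono_Delta[OF assms(1) finite_tuples_paths])
  also have "\<dots> \<le> F G n k \<alpha> \<sigma>"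
    using assms(2) by (intro F_ge) auto
  finally show ?thesis
    using fin by (simp add: integrable_measure_pmf_finite expectation_of_bool)
qed

text \<open>Counting the interceptors that meet some agent bounds the cost of every agent at once,
  hence the maximum; linearity of expectation then separates the interceptors.\<close>

lemma F_le_hit:
  assumes "\<sigma> \<in> Delta (tuples n paths)" "n \<ge> 1" "\<alpha> \<ge> 0"
    and hit: "\<And>e. e \<in> arcs G \<Longrightarrow> measure_pmf.prob \<sigma> {a. \<exists>i<n. e \<in> a i} \<le> b"
  shows "F G n k \<alpha> \<sigma> \<le> real (p_max G s t) + \<alpha> * real k * b"
proof (rule F_le)
  fix d assume d: "d \<in> tuples k (arcs G)"
  have fin: "finite (set_pmf \<sigma>)"
    using assms(1) finite_tuples_paths[of n] by (auto simp: Delta_def intro: finite_subset)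
  have "max_cost n k a d \<alpha> \<le> real (p_max G s t) + \<alpha> * (\<Sum>j<k. of_bool (\<exists>i<n. d j \<in> a i))"
    if a: "a \<in> tuples n paths" for a
  proof (rule max_cost_leI[OF assms(2)])
    fix i assume "i < n"
    then have "a i \<in> paths"
      using a by (auto simp: PiE_iff)
    then have "card (a i) \<le> p_max G s t"
      by (rule card_path_bounds)
    moreover have "(\<Sum>j<k. of_bool (d j \<in> a i)) \<le> (\<Sum>j<k. of_bool (\<exists>i<n. d j \<in> a i) :: real)"
      using \<open>i < n\<close> by (intro sum_mono) auto
    ultimately show "agent_cost k \<alpha> (a i) d \<le>
        real (p_max G s t) + \<alpha> * (\<Sum>j<k. of_bool (\<exists>i<n. d j \<in> a i))"
      unfolding agent_cost_def using assms(3) by (intro add_mono mult_left_mono) auto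
  qed
  then have "measure_pmf.expectation \<sigma> (\<lambda>a. max_cost n k a d \<alpha>) \<le>
      measure_pmf.expectation \<sigma> (\<lambda>a. real (p_max G s t) + \<alpha> * (\<Sum>j<k. of_bool (\<exists>i<n. d j \<in> a i)))"
    by (intro expectation_mono_Delta[OF assms(1) finite_tuples_paths])
  also have "\<dots> = real (p_max G s t) + \<alpha> * (\<Sum>j<k. measure_pmf.prob \<sigma> {a. \<exists>i<n. d j \<in> a i})"
    using fin by (simp add: integrable_measure_pmf_finite expectation_of_bool del: sum_of_bool_eq)
  also have "(\<Sum>j<k. measure_pmf.prob \<sigma> {a. \<exists>i<n. d j \<in> a i}) \<le> (\<Sum>j<k. b)"
    using d hit by (intro sum_mono) auto
  finally show "measure_pmf.expectation \<sigma> (\<lambda>a. max_cost n k a d \<alpha>) \<le>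
      real (p_max G s t) + \<alpha> * real k * b"
    using assms(3) by (simp add: mult_left_mono mult.assoc)
qed

lemma min_cut_arcs:
  obtains C where "C \<subseteq> arcs G" "finite C" "card C = m_c" "C \<noteq> {}"
    "\<forall>p\<in>paths. \<exists>e\<in>C. e \<in> p"
proof -
  obtain S where S: "S \<subseteq> verts G" "s \<in> S" "t \<notin> S" "card (cut_arcs G S) = m_c"
    by (rule min_cut_attained)
  have "\<exists>e\<in>cut_arcs G S. e \<in> p" if "p \<in> paths" for p
    using st_paths_meet_cut[OF that S(2,3)] by blast
  moreover have "cut_arcs G S \<noteq> {}"
    using S(4) min_cut_pos by auto
  ultimately show ?thesis
    using that[of "cut_arcs G S"] S(4) by (auto simp: cut_arcs_def)
qed

text \<open>Some arc of a minimum cut is used with at least the average probability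
  \<open>1 / m_c\<close>, whatever the correlation.\<close>

lemma F_correlated_ge:
  assumes "\<sigma> \<in> correlated G s t n" "n \<ge> 1" "\<alpha> \<ge> 0"
  shows "real (p_min G s t) + \<alpha> * real k / real m_c \<le> F G n k \<alpha> \<sigma>"
proof -
  have \<sigma>: "\<sigma> \<in> Delta (tuples n paths)"
    using assms(1) by (simp add: correlated_def)
  obtain C where C: "C \<subseteq> arcs G" "finite C" "card C = m_c" "C \<noteq> {}"
    "\<forall>p\<in>paths. \<exists>e\<in>C. e \<in> p"
    by (rule min_cut_arcs)
  let ?h = "\<lambda>e. measure_pmf.prob \<sigma> {a. \<exists>i<n. e \<in> a i}"
  \<comment> \<open>The path of agent \<open>0\<close> alone already meets the cut.\<close>
  have "\<exists>e\<in>C. \<exists>i<n. e \<in> a i" if "a \<in> tuples n paths" for a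
    using bspec[OF C(5), of "a 0"] assms(2) that by (force simp: PiE_iff)
  then have "1 \<le> (\<Sum>e\<in>C. ?h e)"
    by (intro sum_prob_ge_1[OF \<sigma> C(2)])
  then have "\<exists>e\<in>C. 1 / real m_c \<le> ?h e"
    using sum_bounded_above_strict[of C ?h "1 / real m_c"] C(3) min_cut_pos by (force simp: not_le)
  then obtain e where e: "e \<in> C" "1 / real m_c \<le> ?h e" ..
  have "real (p_min G s t) + \<alpha> * real k * (1 / real m_c) \<le> real (p_min G s t) + \<alpha> * real k * ?h e"
    using e(2) assms(3) by (intro add_left_mono mult_left_mono) auto
  also have "\<dots> \<le> F G n k \<alpha> \<sigma>"
    using e(1) C(1) assms \<sigma> by (intro F_ge_hit) auto
  finally show ?thesis by simp
qed

lemma E_ln_div: "E_ln m_c n / real m_c = 1 - (1 - 1 / real m_c) ^ n"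
  using min_cut_pos by (simp add: E_ln_def)

text \<open>Independence improves the averaging bound: \<open>exists_large_hit_probability\<close>
  applies to the marginals, each of which meets the cut almost surely.\<close>

lemma F_uncorrelated_ge:
  assumes "\<sigma> \<in> uncorrelated G s t n" "n \<ge> 1" "\<alpha> \<ge> 0"
  shows "real (p_min G s t) + \<alpha> * real k * E_ln m_c n / real m_c \<le> F G n k \<alpha> \<sigma>"
proof -
  obtain \<tau> where \<tau>: "\<sigma> = product_dist n \<tau>" "\<And>i. i < n \<Longrightarrow> \<tau> i \<in> Delta paths"
    using assms(1) by (auto simp: uncorrelated_def)
  obtain C where C: "C \<subseteq> arcs G" "finite C" "card C = m_c" "C \<noteq> {}"
    "\<forall>p\<in>paths. \<exists>e\<in>C. e \<in> p"
    by (rule min_cut_arcs)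
  let ?h = "\<lambda>e. measure_pmf.prob \<sigma> {a. \<exists>i<n. e \<in> a i}"
  have "\<exists>e\<in>C. 1 - (1 - 1 / real (card C)) ^ n \<le> 1 - (\<Prod>i<n. 1 - measure_pmf.prob (\<tau> i) {p. e \<in> p})"
    using C \<tau>(2) by (intro exists_large_hit_probability sum_prob_ge_1) auto
  then obtain e where e: "e \<in> C" "E_ln m_c n / real m_c \<le> ?h e"
    unfolding E_ln_div \<tau>(1) prob_product_dist_ex using C(3) by auto
  have "real (p_min G s t) + \<alpha> * real k * (E_ln m_c n / real m_c) \<le> real (p_min G s t) + \<alpha> * real k * ?h e"
    using e(2) assms(3) by (intro add_left_mono mult_left_mono) auto
  also have "\<dots> \<le> F G n k \<alpha> \<sigma>"
    using e(1) C(1) assms \<tau> by (intro F_ge_hit) (auto intro: product_dist_in_Delta)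
  finally show ?thesis by simp
qed

section \<open>Bounds on the optimal values\<close>

text \<open>An arc lies on at most one of \<open>m_c\<close> disjoint paths, so each agent uses it
  with probability at most \<open>1 / m_c\<close>; independence of the agents turns this into
  \<open>E_ln\<close>.\<close>

lemma min_uniform_le:
  assumes "n \<ge> 1" "\<alpha> \<ge> 0"
  shows "min_over (F G n k \<alpha>) (uniform_strategies G s t n)
    \<le> real (p_max G s t) + \<alpha> * real k * E_ln m_c n / real m_c"
proof -
  obtain M where M: "M \<in> MF G s t" "M \<in> prefixes_of M" "finite M" "card M = m_c" "disjoint M" "M \<subseteq> paths"
    by (rule menger_MF)
  have "M \<noteq> {}"
    using M(4) min_cut_pos by auto
  let ?\<sigma> = "product_dist n (\<lambda>_. pmf_of_set M)"
  have "min_over (F G n k \<alpha>) (uniform_strategies G s t n) \<le> F G n k \<alpha> ?\<sigma>"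
    using M(1,2) by (intro min_over_le attains_min_uniform) (auto simp: uniform_strategies_def)
  also have "\<dots> \<le> real (p_max G s t) + \<alpha> * real k * (E_ln m_c n / real m_c)"
  proof (rule F_le_hit[OF _ assms])
    show "?\<sigma> \<in> Delta (tuples n paths)"
      using M \<open>M \<noteq> {}\<close> by (intro product_dist_in_Delta) (auto simp: Delta_def)
    fix e
    have "card (M \<inter> {p. e \<in> p}) \<le> 1"
      using M(3,5) unfolding One_nat_def
      by (subst card_le_Suc0_iff_eq) (auto simp: disjoint_def)
    then have "measure_pmf.prob (pmf_of_set M) {p. e \<in> p} \<le> 1 / real m_c"
      using M(3,4) \<open>M \<noteq> {}\<close> by (simp add: measure_pmf_of_set divide_right_mono)
    \<comment> \<open>Keeps the factors nonnegative, as monotonicity of the product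
      requires.\<close>
    moreover have "1 / real m_c \<le> 1"
      using min_cut_pos by simp
    ultimately have "(\<Prod>i<n. 1 - 1 / real m_c) \<le> (\<Prod>i<n. 1 - measure_pmf.prob (pmf_of_set M) {p. e \<in> p})"
      by (intro prod_mono) auto
    then show "measure_pmf.prob ?\<sigma> {a. \<exists>i<n. e \<in> a i} \<le> E_ln m_c n / real m_c"
      unfolding E_ln_div prob_product_dist_ex by simp
  qed
  finally show ?thesis by simp
qed

lemma min_correlated_le_min_uniform_1:
  assumes "n \<ge> 1"
  shows "min_over (F G n k \<alpha>) (correlated G s t n) \<le> min_over (F G 1 k \<alpha>) (uniform_strategies G s t 1)"
proof (rule min_over_ge[OF attains_min_uniform])
  fix \<sigma> assume "\<sigma> \<in> uniform_strategies G s t 1"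
  then obtain P where P: "\<sigma> = product_dist 1 (\<lambda>_. pmf_of_set P)" "P \<subseteq> paths" "P \<noteq> {}" "finite P"
    by (rule uniform_strategiesD)
  \<comment> \<open>One path is drawn and handed to all agents, so the maximum is the cost of a
    single agent.\<close>
  let ?\<tau> = "map_pmf (\<lambda>p. \<lambda>i\<in>{..<n}. p) (pmf_of_set P)"
  have "map_pmf (\<lambda>a. a 0) \<sigma> = pmf_of_set P"
    unfolding P(1) product_dist_def by (subst Pi_pmf_component) auto
  then have "measure_pmf.expectation \<sigma> (\<lambda>a. max_cost 1 k a d \<alpha>) =
      measure_pmf.expectation ?\<tau> (\<lambda>a. max_cost n k a d \<alpha>)" for d
    using integral_map_pmf[of "\<lambda>a. a 0" \<sigma> "\<lambda>p. agent_cost k \<alpha> p d"]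
    by (simp only: max_cost_1 integral_map_pmf max_cost_const[OF assms])
  then have "F G 1 k \<alpha> \<sigma> = F G n k \<alpha> ?\<tau>"
    by (simp add: F_def)
  moreover have "?\<tau> \<in> correlated G s t n"
    using P by (auto simp: correlated_def Delta_def)
  ultimately show "min_over (F G n k \<alpha>) (correlated G s t n) \<le> F G 1 k \<alpha> \<sigma>"
    using min_over_le[OF attains_min_correlated] by simp
qed

text \<open>Every agent independently follows the law of agent \<open>0\<close> under an optimal
  correlated \<open>\<sigma>\<close>. A maximum of nonnegative costs is at most their sum, and each
  of the \<open>n\<close> terms has an expectation at most that of the maximal cost under
  \<open>\<sigma>\<close>.\<close>

lemma min_uncorrelated_le_n_min_correlated:
  assumes "n \<ge> 1" "\<alpha> \<ge> 0"
  shows "min_over (F G n k \<alpha>) (uncorrelated G s t n)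
    \<le> real n * min_over (F G n k \<alpha>) (correlated G s t n)"
proof -
  obtain \<sigma> where \<sigma>: "\<sigma> \<in> correlated G s t n" "min_over (F G n k \<alpha>) (correlated G s t n) = F G n k \<alpha> \<sigma>"
    by (rule min_over_attained[OF attains_min_correlated])
  then have \<sigma>': "\<sigma> \<in> Delta (tuples n paths)"
    by (simp add: correlated_def)
  define \<tau> where "\<tau> = map_pmf (\<lambda>a. a 0) \<sigma>"
  have \<tau>: "\<tau> \<in> Delta paths"
    using \<sigma>' assms(1) by (fastforce simp: \<tau>_def Delta_def PiE_iff)
  let ?\<pi> = "product_dist n (\<lambda>_. \<tau>)"
  have \<pi>: "?\<pi> \<in> Delta (tuples n paths)"
    using \<tau> by (intro product_dist_in_Delta)
  then have fin: "finite (set_pmf ?\<pi>)"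
    using finite_tuples_paths[of n] by (auto simp: Delta_def intro: finite_subset)
  have "F G n k \<alpha> ?\<pi> \<le> real n * F G n k \<alpha> \<sigma>"
  proof (rule F_le)
    fix d assume d: "d \<in> tuples k (arcs G)"
    have "max_cost n k a d \<alpha> \<le> (\<Sum>i<n. agent_cost k \<alpha> (a i) d)" for a
      using assms by (intro max_cost_leI member_le_sum) (auto simp: agent_cost_nonneg)
    then have "measure_pmf.expectation ?\<pi> (\<lambda>a. max_cost n k a d \<alpha>)
        \<le> measure_pmf.expectation ?\<pi> (\<lambda>a. \<Sum>i<n. agent_cost k \<alpha> (a i) d)"
      by (intro expectation_mono_Delta[OF \<pi> finite_tuples_paths])
    also have "\<dots> = (\<Sum>i<n. measure_pmf.expectation ?\<pi> (\<lambda>a. agent_cost k \<alpha> (a i) d))"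
      using fin by (simp add: integrable_measure_pmf_finite)
    also have "\<dots> = (\<Sum>i<n. measure_pmf.expectation \<tau> (\<lambda>p. agent_cost k \<alpha> p d))"
    proof (intro sum.cong refl)
      fix i assume "i \<in> {..<n}"
      then have "map_pmf (\<lambda>a. a i) ?\<pi> = \<tau>"
        unfolding product_dist_def by (subst Pi_pmf_component) auto
      then show "measure_pmf.expectation ?\<pi> (\<lambda>a. agent_cost k \<alpha> (a i) d)
          = measure_pmf.expectation \<tau> (\<lambda>p. agent_cost k \<alpha> p d)"
        using integral_map_pmf[of "\<lambda>a. a i" ?\<pi> "\<lambda>p. agent_cost k \<alpha> p d"] by simp
    qed
    also have "\<dots> = real n * measure_pmf.expectation \<sigma> (\<lambda>a. agent_cost k \<alpha> (a 0) d)"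
      by (simp add: \<tau>_def)
    also have "measure_pmf.expectation \<sigma> (\<lambda>a. agent_cost k \<alpha> (a 0) d)
        \<le> measure_pmf.expectation \<sigma> (\<lambda>a. max_cost n k a d \<alpha>)"
      using assms(1) by (intro expectation_mono_Delta[OF \<sigma>' finite_tuples_paths] agent_cost_le_max_cost) auto
    also have "\<dots> \<le> F G n k \<alpha> \<sigma>"
      by (rule F_ge[OF d])
    finally show "measure_pmf.expectation ?\<pi> (\<lambda>a. max_cost n k a d \<alpha>) \<le> real n * F G n k \<alpha> \<sigma>"
      by (simp add: mult_left_mono)
  qed
  moreover have "?\<pi> \<in> uncorrelated G s t n"
    using \<tau> by (intro product_dist_in_uncorrelated)
  ultimately show ?thesis
    using order_trans[OF min_over_le[OF attains_min_uncorrelated]] \<sigma>(2) by simp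
qed

text \<open>In the worst case all \<open>k\<close> interceptors stand on the one path in
  use.\<close>

lemma min_uncorrelated_le_shortest_path:
  assumes "n \<ge> 1" "\<alpha> \<ge> 0"
  shows "min_over (F G n k \<alpha>) (uncorrelated G s t n) \<le> real (p_min G s t) + \<alpha> * real k"
proof -
  obtain p where p: "p \<in> paths" "card p = p_min G s t"
    by (rule shortest_path)
  let ?\<pi> = "product_dist n (\<lambda>_. return_pmf p)"
  have \<pi>: "?\<pi> = return_pmf (\<lambda>i. if i < n then p else undefined)"
    unfolding product_dist_def by (subst Pi_pmf_return_pmf) auto
  have "F G n k \<alpha> ?\<pi> \<le> real (p_min G s t) + \<alpha> * real k"
  proof (rule F_le)
    fix d :: "nat \<Rightarrow> 'e"
    have "(\<Sum>j<k. of_bool (d j \<in> p)) \<le> (\<Sum>j<k. 1 :: real)"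
      by (intro sum_mono) auto
    then have "agent_cost k \<alpha> p d \<le> real (p_min G s t) + \<alpha> * real k"
      using assms(2) p(2) by (auto simp: agent_cost_def intro: mult_left_mono)
    then show "measure_pmf.expectation ?\<pi> (\<lambda>a. max_cost n k a d \<alpha>) \<le> real (p_min G s t) + \<alpha> * real k"
      unfolding \<pi> using assms(1) by (auto intro: max_cost_leI)
  qed
  moreover have "?\<pi> \<in> uncorrelated G s t n"
    using p(1) by (intro product_dist_in_uncorrelated) (auto simp: Delta_def)
  ultimately show ?thesis
    by (rule order_trans[OF min_over_le[OF attains_min_uncorrelated], rotated])
qed

lemma E_ln_1: "E_ln m_c 1 = 1"
  using min_cut_pos by (simp add: E_ln_def)

text \<open>The base \<open>1 - 1 / real m_c\<close> lies between 0 and 1, so its powers decrease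
  and \<open>n = 1\<close> is the extreme case.\<close>

lemma E_ln_ge_1:
  assumes "n \<ge> 1"
  shows "1 \<le> E_ln m_c n"
proof -
  have "(1 - 1 / real m_c) ^ n \<le> (1 - 1 / real m_c) ^ 1"
    using assms min_cut_pos by (intro power_decreasing) auto
  then have "1 / real m_c \<le> E_ln m_c n / real m_c"
    by (simp add: E_ln_div)
  then show ?thesis
    using min_cut_pos by (simp add: field_simps)
qed

lemma min_correlated_ge:
  assumes "n \<ge> 1" "\<alpha> \<ge> 0"
  shows "real (p_min G s t) + \<alpha> * real k / real m_c \<le> min_over (F G n k \<alpha>) (correlated G s t n)"
  using assms by (intro min_over_ge attains_min_correlated F_correlated_ge)

text \<open>Copying reduces this to the uniform bound for one agent, where \<open>E_ln\<close>
  equals one.\<close>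

lemma min_correlated_le:
  assumes "n \<ge> 1" "\<alpha> \<ge> 0"
  shows "min_over (F G n k \<alpha>) (correlated G s t n) \<le> real (p_max G s t) + \<alpha> * real k / real m_c"
  using min_correlated_le_min_uniform_1[of n k \<alpha>] min_uniform_le[of 1 \<alpha> k] assms E_ln_1 by simp

lemma min_uncorrelated_ge:
  assumes "n \<ge> 1" "\<alpha> \<ge> 0"
  shows "real (p_min G s t) + \<alpha> * real k * E_ln m_c n / real m_c
    \<le> min_over (F G n k \<alpha>) (uncorrelated G s t n)"
  using assms by (intro min_over_ge attains_min_uncorrelated F_uncorrelated_ge)

lemma min_uncorrelated_le_min_uniform:
  "min_over (F G n k \<alpha>) (uncorrelated G s t n) \<le> min_over (F G n k \<alpha>) (uniform_strategies G s t n)"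
  using uniform_subset_uncorrelated
  by (intro min_over_ge attains_min_uniform min_over_le attains_min_uncorrelated) auto

section \<open>The price of uncorrelation and its limit\<close>

text \<open>Both bounds are quotients of affine functions of \<open>\<alpha>\<close>, with the same
  leading coefficients above and below; this form feeds the limit.\<close>

lemma price_of_uncorrelation_bounds:
  assumes "n \<ge> 1" "k \<ge> 1" "\<alpha> > 0"
  shows "(real (p_min G s t) + \<alpha> * (real k * E_ln m_c n / real m_c)) / (real (p_max G s t) + \<alpha> * (real k / real m_c))
      \<le> price_of_uncorrelation G s t n k \<alpha>"
    and "price_of_uncorrelation G s t n k \<alpha>
      \<le> (real (p_max G s t) + \<alpha> * (real k * E_ln m_c n / real m_c)) / (real (p_min G s t) + \<alpha> * (real k / real m_c))"
proof -
  have pos: "0 < \<alpha> * real k / real m_c"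
    using assms min_cut_pos by simp
  have E: "0 \<le> \<alpha> * real k * E_ln m_c n / real m_c"
    using assms E_ln_ge_1[of n] by simp
  note bounds = min_correlated_ge[of n \<alpha> k] min_correlated_le[of n \<alpha> k] min_uncorrelated_ge[of n \<alpha> k]
    order_trans[OF min_uncorrelated_le_min_uniform min_uniform_le[of n \<alpha> k]]
  show "(real (p_min G s t) + \<alpha> * (real k * E_ln m_c n / real m_c)) / (real (p_max G s t) + \<alpha> * (real k / real m_c))
      \<le> price_of_uncorrelation G s t n k \<alpha>"
    unfolding price_of_uncorrelation_def
    using assms bounds pos E by (intro frac_le) (auto simp: mult.assoc)
  show "price_of_uncorrelation G s t n k \<alpha>
      \<le> (real (p_max G s t) + \<alpha> * (real k * E_ln m_c n / real m_c)) / (real (p_min G s t) + \<alpha> * (real k / real m_c))"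
    unfolding price_of_uncorrelation_def
    using assms bounds pos E by (intro frac_le) (auto simp: mult.assoc)
qed

lemma price_of_uncorrelation_tendsto:
  assumes "n \<ge> 1" "k \<ge> 1"
  shows "(price_of_uncorrelation G s t n k \<longlongrightarrow> E_ln m_c n) at_top"
proof -
  \<comment> \<open>A single positive constant in place of the quotient, so that
    \<open>real_asymp\<close> finds the sign of the leading coefficient.\<close>
  define d where "d = real k / real m_c"
  have d: "d > 0"
    using assms(2) min_cut_pos by (simp add: d_def)
  have lim: "((\<lambda>x. (a + x * (real k * E_ln m_c n / real m_c)) / (c + x * (real k / real m_c))) \<longlongrightarrow> E_ln m_c n) at_top" for a c
  proof -
    have "((\<lambda>x. (a + x * (d * E_ln m_c n)) / (c + x * d)) \<longlongrightarrow> d * E_ln m_c n / d) at_top"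
      using d by real_asymp
    moreover have "d * E_ln m_c n / d = E_ln m_c n"
      using d by simp
    ultimately show ?thesis
      by (simp only: d_def times_divide_eq_left)
  qed
  show ?thesis
  proof (rule tendsto_sandwich[OF _ _ lim lim])
    show "\<forall>\<^sub>F x in at_top. (real (p_min G s t) + x * (real k * E_ln m_c n / real m_c)) / (real (p_max G s t) + x * (real k / real m_c))
      \<le> price_of_uncorrelation G s t n k x"
      using eventually_gt_at_top[of 0] by eventually_elim (rule price_of_uncorrelation_bounds[OF assms])
    show "\<forall>\<^sub>F x in at_top. price_of_uncorrelation G s t n k x
      \<le> (real (p_max G s t) + x * (real k * E_ln m_c n / real m_c)) / (real (p_min G s t) + x * (real k / real m_c))"
      using eventually_gt_at_top[of 0] by eventually_elim (rule price_of_uncorrelation_bounds[OF assms])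
  qed
qed

end

section \<open>Arithmetic with the bounds on the optimal values\<close>

theorem corollary2:
  fixes G :: "('v, 'e) pre_digraph" and s t :: 'v and n k :: nat and \<alpha> \<epsilon> :: real
  assumes "st_dag G s t"
    and "n \<ge> 1" and "k \<ge> 1"
    and "\<alpha> > 0"
    and "\<alpha> > (real (p_max G s t) - real (p_min G s t)) / real k"
    and "\<epsilon> > 0"
  shows
    "(\<alpha> \<ge> real (min_cut G s t) / (real k * \<epsilon> * E_ln (min_cut G s t) n)
            * (real n * real (p_max G s t) - (1 + \<epsilon>) * real (p_min G s t))
        \<longrightarrow> min_over (F G n k \<alpha>) (uniform_strategies G s t n)
              \<le> (1 + \<epsilon>) * min_over (F G n k \<alpha>) (uncorrelated G s t n))
     \<and> (\<alpha> \<ge> real (min_cut G s t) / (real k * \<epsilon>)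
            * (real n * real (p_max G s t) - (1 + \<epsilon>) * real (p_min G s t))
        \<longrightarrow> price_of_uncorrelation G s t n k \<alpha> / uniform_price_of_uncorrelation G s t n k \<alpha>
              \<in> {1 / (1 + \<epsilon>) .. 1 + \<epsilon>})
     \<and> price_of_uncorrelation G s t n k \<alpha> \<le> min (real (min_cut G s t)) (real n)
     \<and> (\<alpha> \<ge> real (min_cut G s t) / (real k * E_ln (min_cut G s t) n * \<epsilon>)
            * (real n * real (p_max G s t)
                - (1 + \<epsilon>) * E_ln (min_cut G s t) n * real (p_min G s t))
        \<longrightarrow> price_of_uncorrelation G s t n k \<alpha> \<le> (1 + \<epsilon>) * E_ln (min_cut G s t) n)
     \<and> (\<alpha> \<ge> real (min_cut G s t) / (real k * E_ln (min_cut G s t) n * \<epsilon>)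
            * ((1 - \<epsilon>) * E_ln (min_cut G s t) n * real n * real (p_max G s t)
                - real (p_min G s t))
        \<longrightarrow> price_of_uncorrelation G s t n k \<alpha> \<ge> (1 - \<epsilon>) * E_ln (min_cut G s t) n)
     \<and> ((\<lambda>\<alpha>'. price_of_uncorrelation G s t n k \<alpha>') \<longlongrightarrow> E_ln (min_cut G s t) n) at_top"
proof -
  interpret st_dag G s t by fact
  define E where "E = E_ln m_c n"
  define A where "A = \<alpha> * real k / real m_c"
  define l where "l = real (p_min G s t)"
  define L where "L = real (p_max G s t)"
  define VC where "VC = min_over (F G n k \<alpha>) (correlated G s t n)"
  define VU where "VU = min_over (F G n k \<alpha>) (uncorrelated G s t n)"
  define Vn where "Vn = min_over (F G n k \<alpha>) (uniform_strategies G s t n)"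
  define U1 where "U1 = min_over (F G 1 k \<alpha>) (uniform_strategies G s t 1)"
  note defs = E_def A_def l_def L_def VC_def VU_def Vn_def U1_def
  have m_c: "real m_c \<ge> 1" and nk: "real n \<ge> 1" "real k \<ge> 1" and \<alpha>: "\<alpha> \<ge> 0"
    using min_cut_pos assms by auto
  have E: "E \<ge> 1"
    unfolding E_def by (rule E_ln_ge_1[OF assms(2)])
  have A: "A > 0"
    using m_c nk assms(4) by (simp add: A_def)
  \<comment> \<open>The thresholds on \<open>\<alpha>\<close> contain \<open>real n * L\<close> and
    the value bounds contain \<open>L\<close>; \<open>nL\<close> passes between them.\<close>
  have l: "l \<ge> 0" and L: "L \<ge> 0" and nL: "L \<le> real n * L"
    using nk(1) by (auto simp: l_def L_def mult_le_cancel_right1)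
  have VC: "l + A \<le> VC" "VC \<le> U1"
    using min_correlated_ge[OF assms(2) \<alpha>] min_correlated_le_min_uniform_1[OF assms(2)]
    by (auto simp: defs)
  have U1: "U1 \<le> L + A"
    using min_uniform_le[of 1 \<alpha> k] \<alpha> E_ln_1 by (simp add: defs)
  have VU: "l + A * E \<le> VU" "VU \<le> Vn" "VU \<le> real n * VC" "VU \<le> l + real m_c * A"
    using min_uncorrelated_ge[OF assms(2) \<alpha>] min_uncorrelated_le_min_uniform[of n k \<alpha>] m_c
      min_uncorrelated_le_n_min_correlated[OF assms(2) \<alpha>] min_uncorrelated_le_shortest_path[OF assms(2) \<alpha>]
    by (auto simp: defs)
  have Vn: "Vn \<le> L + A * E"
    using min_uniform_le[OF assms(2) \<alpha>] by (simp add: defs)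
  have price: "price_of_uncorrelation G s t n k \<alpha> = VU / VC"
    "uniform_price_of_uncorrelation G s t n k \<alpha> = Vn / U1"
    by (simp_all add: price_of_uncorrelation_def uniform_price_of_uncorrelation_def defs)
  have VCpos: "VC > 0" and VUpos: "VU > 0"
    using VC(1) VU(1) A l mult_pos_pos[of A E] E by linarith+
  \<comment> \<open>Clears the denominators in all thresholds: \<open>c\<close> is \<open>1\<close>
    in part (b) and \<open>E\<close> elsewhere.\<close>
  have threshold: "X \<le> A * (\<epsilon> * c)" if "\<alpha> \<ge> real m_c / (real k * (\<epsilon> * c)) * X" "c \<ge> 1" for X c
  proof -
    have "0 < real k * (\<epsilon> * c)"
      using nk assms(6) that(2) by simp
    with that(1) m_c show ?thesis
      by (simp add: A_def field_simps)
  qed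
  have a: "Vn \<le> (1 + \<epsilon>) * VU" if "real n * L - (1 + \<epsilon>) * l \<le> A * (\<epsilon> * E)"
  proof -
    have "Vn \<le> (1 + \<epsilon>) * (l + A * E)"
      using Vn nL that by (simp add: algebra_simps)
    also have "\<dots> \<le> (1 + \<epsilon>) * VU"
      using VU(1) assms(6) by (intro mult_left_mono) auto
    finally show ?thesis .
  qed
  \<comment> \<open>The ratio of prices is \<open>VU / Vn\<close> times \<open>U1 / VC\<close>. The
    first factor lies in \<open>{1 / (1 + \<epsilon>) .. 1}\<close>, the second in
    \<open>{1 .. 1 + \<epsilon>}\<close>.\<close>
  have b: "VU / VC / (Vn / U1) \<in> {1 / (1 + \<epsilon>) .. 1 + \<epsilon>}" if h: "real n * L - (1 + \<epsilon>) * l \<le> A * \<epsilon>"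
  proof -
    have "A * \<epsilon> \<le> A * (\<epsilon> * E)"
      using A E assms(6) by (intro mult_left_mono) auto
    with a h have "Vn \<le> (1 + \<epsilon>) * VU" by simp
    then have "1 / (1 + \<epsilon>) \<le> VU / Vn" "VU / Vn \<le> 1"
      using VU(2) VUpos assms(6) by (auto simp: field_simps)
    have "U1 \<le> (1 + \<epsilon>) * (l + A)"
      using U1 nL h by (simp add: algebra_simps)
    also have "\<dots> \<le> (1 + \<epsilon>) * VC"
      using VC(1) assms(6) by (intro mult_left_mono) auto
    finally have "1 \<le> U1 / VC" "U1 / VC \<le> 1 + \<epsilon>"
      using VC(2) VCpos by (auto simp: field_simps)
    have "1 / (1 + \<epsilon>) * 1 \<le> VU / Vn * (U1 / VC)" "VU / Vn * (U1 / VC) \<le> 1 * (1 + \<epsilon>)"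
      using VUpos VCpos VU(2) VC(2)
      by (intro mult_mono \<open>1 / (1 + \<epsilon>) \<le> VU / Vn\<close> \<open>VU / Vn \<le> 1\<close> \<open>1 \<le> U1 / VC\<close> \<open>U1 / VC \<le> 1 + \<epsilon>\<close>; simp)+
    then show ?thesis by (simp add: mult.commute)
  qed
  \<comment> \<open>The bound by \<open>m_c\<close> comes from the shortest path strategy, the bound
    by \<open>n\<close> from imitation of agent \<open>0\<close>.\<close>
  have c1: "VU / VC \<le> min (real m_c) (real n)"
  proof -
    have "VU \<le> real m_c * (l + A)"
      using VU(4) m_c l by (simp add: distrib_left mult_le_cancel_right1 add_increasing order_trans)
    also have "\<dots> \<le> real m_c * VC"
      using VC(1) by (intro mult_left_mono) auto
    finally show ?thesis
      using VU(3) VCpos by (simp add: pos_divide_le_eq)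
  qed
  have c2: "VU / VC \<le> (1 + \<epsilon>) * E" if "real n * L - (1 + \<epsilon>) * E * l \<le> A * (\<epsilon> * E)"
  proof -
    have "VU \<le> (1 + \<epsilon>) * E * (l + A)"
      using VU(2) Vn nL that by (simp add: algebra_simps)
    also have "\<dots> \<le> (1 + \<epsilon>) * E * VC"
      using VC(1) E assms(6) by (intro mult_left_mono) auto
    finally show ?thesis
      using VCpos by (simp add: pos_divide_le_eq)
  qed
  \<comment> \<open>Multiplying by \<open>1 - \<epsilon>\<close> preserves inequalities only if
    \<open>\<epsilon> < 1\<close>; otherwise the left side is nonpositive and the claim is
    immediate.\<close>
  have c3: "(1 - \<epsilon>) * E \<le> VU / VC" if h: "(1 - \<epsilon>) * E * real n * L - l \<le> A * (\<epsilon> * E)"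
  proof (cases "\<epsilon> < 1")
    case True
    have "(1 - \<epsilon>) * E * L \<le> (1 - \<epsilon>) * E * (real n * L)"
      using True E nL by (intro mult_left_mono) auto
    then have "(1 - \<epsilon>) * E * (L + A) \<le> l + A * E"
      using h by (simp add: algebra_simps)
    moreover have "(1 - \<epsilon>) * E * VC \<le> (1 - \<epsilon>) * E * (L + A)"
      using True E VC(2) U1 by (intro mult_left_mono) auto
    ultimately show ?thesis
      using VU(1) VCpos by (simp add: pos_le_divide_eq)
  next
    case False
    then have "(1 - \<epsilon>) * E \<le> 0"
      using E by (simp add: mult_nonpos_nonneg)
    also have "0 \<le> VU / VC"
      using VUpos VCpos by simp
    finally show ?thesis .
  qed
  have c4: "((\<lambda>\<alpha>'. price_of_uncorrelation G s t n k \<alpha>') \<longlongrightarrow> E) at_top"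
    unfolding E_def by (rule price_of_uncorrelation_tendsto[OF assms(2,3)])
  show ?thesis
    \<comment> \<open>\<open>price\<close> speaks of the fixed \<open>\<alpha>\<close>, so the limit
      clause with its bound variable is left as it stands.\<close>
    unfolding price
    unfolding E_def[symmetric] l_def[symmetric] L_def[symmetric] VU_def[symmetric] Vn_def[symmetric]
  proof (intro conjI impI)
    show "Vn \<le> (1 + \<epsilon>) * VU"
      if "\<alpha> \<ge> real m_c / (real k * \<epsilon> * E) * (real n * L - (1 + \<epsilon>) * l)"
      using that threshold[of E] E by (intro a) (simp add: mult.assoc)
    show "VU / VC / (Vn / U1) \<in> {1 / (1 + \<epsilon>) .. 1 + \<epsilon>}"
      if "\<alpha> \<ge> real m_c / (real k * \<epsilon>) * (real n * L - (1 + \<epsilon>) * l)"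
      using that threshold[of 1] by (intro b) simp
    show "VU / VC \<le> min (real m_c) (real n)"
      by (rule c1)
    show "VU / VC \<le> (1 + \<epsilon>) * E"
      if "\<alpha> \<ge> real m_c / (real k * E * \<epsilon>) * (real n * L - (1 + \<epsilon>) * E * l)"
      using that threshold[of E] E by (intro c2) (simp add: ac_simps)
    show "(1 - \<epsilon>) * E \<le> VU / VC"
      if "\<alpha> \<ge> real m_c / (real k * E * \<epsilon>) * ((1 - \<epsilon>) * E * real n * L - l)"
      using that threshold[of E] E by (intro c3) (simp add: ac_simps)
    show "((\<lambda>\<alpha>'. price_of_uncorrelation G s t n k \<alpha>') \<longlongrightarrow> E) at_top"
      by (rule c4)
  qed
qed

end
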